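(* Let $\widetilde G=(I,P;E)$ be a pinned $d$-isostatic graph. Then $\widetilde G$ has a $d$-directed orientation, and for any such orientation the following three decompositions of $\widetilde G$ coincide (same partition of the inner vertices into components, same edges assigned to each component, and the same partial order among the components): (1) the $d$-Assur decomposition of $\widetilde G$; (2) the strongly connected decomposition into extended components associated with the $d$-directed orientation, with all pinned vertices identified into one ground vertex; (3) the lower block-triangular decomposition of the pinned rigidity matrix $R(\widetilde G,p)$ at a generic configuration $p$ with the maximal number of diagonal blocks, for some linear order of the blocks extending the partial order of (1), equivalently of (2).
   Context: Fix $d\ge1$. A pinned graph $\widetilde G=(I,P;E)$ has disjoint finite sets $I$ (inner) and $P$ (pinned) of vertices and a finite multiset $E$ of edges, each an unordered pair of distinct vertices with at least one endpoint in $I$. A configuration $p$ assigns $p_v\in\mathbb R^d$ to each vertex. The pinned rigidity matrix $R(\widetilde G,p)$ is the $|E|\times d|I|$ matrix with one row per edge and $d$ columns per inner vertex: the row of $\{i,j\}$, $i,j\in I$, has $p_i-p_j$ in the columns of $i$, $p_j-p_i$ in the columns of $j$, zeros elsewhere; the row of $\{i,k\}$, $i\in I$, $k\in P$, has $p_i-p_k$ in the columns of $i$, zeros elsewhere. $p$ is generic if it lies in the open dense set where $R(\widetilde G,p)$ attains its maximum rank. A pinned graph is pinned $d$-isostatic if for some (equivalently every generic) $p$ its pinned rigidity matrix is square and invertible; it is $d$-Assur if moreover it has no pinned $d$-isostatic subgraph $(I',P';E')$ with $\emptyset\neq I'\subsetneq I$. A $d$-directed orientation orients each edge so every inner vertex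 has out-degree $d$ and every pinned vertex out-degree $0$. Decomposition (1): start with the ground set consisting of the pinned vertices; repeatedly choose a minimal pinned $d$-isostatic subgraph of $\widetilde G$ whose pinned vertices are current ground vertices and whose inner vertices are not yet in the ground (a $d$-Assur component), then add its inner vertices to the ground; stop when all vertices are in the ground. A component $A$ lies above a component $B$ if some edge of $A$ has an endpoint in $B$ (partial order = transitive closure). Decomposition (2): contract all pinned vertices into one ground vertex, take the strongly connected components other than the ground; each component $C$ is extended by all edges directed out of vertices of $C$. $A$ lies above $B$ if there is a directed edge from $A$ into $B$ (transitive closure). Decomposition (3): permute rows and inner vertices (keeping each vertex's $d$ columns together) so that $R(\widetilde G,p)$ becomes lower block-triangular with square diagonal blocks; each block corresponds to a set of inner vertices (columns) and edges (rows). *)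

theory Defs
  imports
    "Jordan_Normal_Form.DL_Rank"
    "Graph_Theory.Digraph_Component"
begin

text \<open>The finite multiset of edges is a finite set of edge names together with a map
  sending each name to its unordered pair of end vertices; parallel edges are distinct names
  with the same ends.\<close>

record ('v, 'e) pgraph =
  inner_verts :: "'v set"
  pinned_verts :: "'v set"
  edges :: "'e set"
  ends :: "'e \<Rightarrow> 'v set"

definition pinned_graph :: "('v, 'e) pgraph \<Rightarrow> bool" where
  "pinned_graph G \<longleftrightarrow>
     finite (inner_verts G) \<and> finite (pinned_verts G) \<and> finite (edges G) \<and>
     inner_verts G \<inter> pinned_verts G = {} \<and>
     (\<forall>e\<in>edges G. card (ends G e) = 2 \<and> ends G e \<subseteq> inner_verts G \<union> pinned_verts G \<and>
        ends G e \<inter> inner_verts G \<noteq> {})"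

definition configuration :: "nat \<Rightarrow> ('v, 'e) pgraph \<Rightarrow> ('v \<Rightarrow> real vec) \<Rightarrow> bool" where
  "configuration d G p \<longleftrightarrow> (\<forall>v \<in> inner_verts G \<union> pinned_verts G. p v \<in> carrier_vec d)"

definition other_end :: "('v, 'e) pgraph \<Rightarrow> 'e \<Rightarrow> 'v \<Rightarrow> 'v" where
  "other_end G e v = (THE w. w \<in> ends G e \<and> w \<noteq> v)"

text \<open>The \<open>d\<close> entries of row \<open>e\<close> of the rigidity matrix in the columns of an inner vertex \<open>v\<close>.\<close>

definition rigidity_entries ::
    "nat \<Rightarrow> ('v, 'e) pgraph \<Rightarrow> ('v \<Rightarrow> real vec) \<Rightarrow> 'e \<Rightarrow> 'v \<Rightarrow> real vec" where
  "rigidity_entries d G p e v = (if v \<in> ends G e then p v - p (other_end G e v) else 0\<^sub>v d)"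

definition enumerates :: "'a list \<Rightarrow> 'a set \<Rightarrow> bool" where
  "enumerates xs A \<longleftrightarrow> distinct xs \<and> set xs = A"

text \<open>The pinned rigidity matrix with the rows in the order \<open>es\<close> and the inner vertices (each
  with its \<open>d\<close> consecutive columns) in the order \<open>vs\<close>. Choosing other enumerations amounts to
  permuting rows and inner vertices.\<close>

definition rigidity_matrix ::
    "nat \<Rightarrow> ('v, 'e) pgraph \<Rightarrow> ('v \<Rightarrow> real vec) \<Rightarrow> 'e list \<Rightarrow> 'v list \<Rightarrow> real mat" where
  "rigidity_matrix d G p es vs =
     mat (length es) (d * length vs)
       (\<lambda>(r, c). rigidity_entries d G p (es ! r) (vs ! (c div d)) $ (c mod d))"

definition generic :: "nat \<Rightarrow> ('v, 'e) pgraph \<Rightarrow> ('v \<Rightarrow> real vec) \<Rightarrow> bool" where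
  "generic d G p \<longleftrightarrow> configuration d G p \<and>
     (\<forall>es vs q. enumerates es (edges G) \<longrightarrow> enumerates vs (inner_verts G) \<longrightarrow> configuration d G q \<longrightarrow>
        vec_space.rank (length es) (rigidity_matrix d G q es vs)
          \<le> vec_space.rank (length es) (rigidity_matrix d G p es vs))"

definition pinned_isostatic :: "nat \<Rightarrow> ('v, 'e) pgraph \<Rightarrow> bool" where
  "pinned_isostatic d G \<longleftrightarrow> pinned_graph G \<and>
     (\<exists>p es vs. configuration d G p \<and> enumerates es (edges G) \<and> enumerates vs (inner_verts G) \<and>
        invertible_mat (rigidity_matrix d G p es vs))"

definition pinned_subgraph :: "('v, 'e) pgraph \<Rightarrow> ('v, 'e) pgraph \<Rightarrow> bool" where
  "pinned_subgraph H G \<longleftrightarrow> pinned_graph H \<and>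
     inner_verts H \<subseteq> inner_verts G \<and> pinned_verts H \<subseteq> pinned_verts G \<and>
     edges H \<subseteq> edges G \<and> ends H = ends G"

definition assur :: "nat \<Rightarrow> ('v, 'e) pgraph \<Rightarrow> bool" where
  "assur d G \<longleftrightarrow> pinned_isostatic d G \<and>
     \<not> (\<exists>H. pinned_subgraph H G \<and> pinned_isostatic d H \<and>
            inner_verts H \<noteq> {} \<and> inner_verts H \<subset> inner_verts G)"

type_synonym ('v, 'e) component = "'v set \<times> 'e set"

text \<open>The reflexive partial order generated on the components \<open>D\<close> by a relation \<open>R\<close> (lies above);
  \<open>(A, B)\<close> belongs to it if \<open>A\<close> is above or equal to \<open>B\<close>.\<close>

definition component_order :: "'c set \<Rightarrow> ('c \<Rightarrow> 'c \<Rightarrow> bool) \<Rightarrow> ('c \<times> 'c) set" where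
  "component_order D R = ({(A, B). A \<in> D \<and> B \<in> D \<and> R A B} \<union> Id_on D)\<^sup>+"

text \<open>A subgraph of \<open>G\<close> pinned in the current ground set \<open>\<Gamma>\<close> (which may contain inner vertices
  of \<open>G\<close>), with a nonempty set of inner vertices outside \<open>\<Gamma>\<close>, that is minimal pinned isostatic.\<close>

definition assur_component ::
    "nat \<Rightarrow> ('v, 'e) pgraph \<Rightarrow> 'v set \<Rightarrow> ('v, 'e) pgraph \<Rightarrow> bool" where
  "assur_component d G \<Gamma> H \<longleftrightarrow> assur d H \<and>
     inner_verts H \<noteq> {} \<and> inner_verts H \<subseteq> inner_verts G - \<Gamma> \<and> pinned_verts H \<subseteq> \<Gamma> \<and>
     edges H \<subseteq> edges G \<and> ends H = ends G"

definition ground :: "('v, 'e) pgraph \<Rightarrow> ('v, 'e) pgraph list \<Rightarrow> 'v set" where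
  "ground G Hs = pinned_verts G \<union> (\<Union>H\<in>set Hs. inner_verts H)"

inductive assur_run :: "nat \<Rightarrow> ('v, 'e) pgraph \<Rightarrow> ('v, 'e) pgraph list \<Rightarrow> bool"
  for d :: nat and G :: "('v, 'e) pgraph" where
  start: "assur_run d G []"
| step: "assur_run d G Hs \<Longrightarrow> assur_component d G (ground G Hs) H \<Longrightarrow> assur_run d G (Hs @ [H])"

definition complete_assur_run :: "nat \<Rightarrow> ('v, 'e) pgraph \<Rightarrow> ('v, 'e) pgraph list \<Rightarrow> bool" where
  "complete_assur_run d G Hs \<longleftrightarrow>
     assur_run d G Hs \<and> ground G Hs = inner_verts G \<union> pinned_verts G"

definition assur_components :: "('v, 'e) pgraph list \<Rightarrow> ('v, 'e) component set" where
  "assur_components Hs = (\<lambda>H. (inner_verts H, edges H)) ` set Hs"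

definition assur_above ::
    "('v, 'e) pgraph \<Rightarrow> ('v, 'e) component \<Rightarrow> ('v, 'e) component \<Rightarrow> bool" where
  "assur_above G A B \<longleftrightarrow> (\<exists>e\<in>snd A. ends G e \<inter> fst B \<noteq> {})"

definition directed_orientation ::
    "nat \<Rightarrow> ('v, 'e) pgraph \<Rightarrow> ('v, 'e) pre_digraph \<Rightarrow> bool" where
  "directed_orientation d G D \<longleftrightarrow>
     verts D = inner_verts G \<union> pinned_verts G \<and> arcs D = edges G \<and>
     (\<forall>e\<in>edges G. ends G e = {tail D e, head D e}) \<and>
     (\<forall>v\<in>inner_verts G. out_degree D v = d) \<and>
     (\<forall>v\<in>pinned_verts G. out_degree D v = 0)"

text \<open>All pinned vertices are identified into the single ground vertex \<^const>\<open>None\<close>.\<close>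

definition contract_pinned ::
    "('v, 'e) pgraph \<Rightarrow> ('v, 'e) pre_digraph \<Rightarrow> ('v option, 'e) pre_digraph" where
  "contract_pinned G D =
     (let c = (\<lambda>v. if v \<in> pinned_verts G then None else Some v) in
      \<lparr> verts = insert None (Some ` inner_verts G), arcs = arcs D,
        tail = (\<lambda>e. c (tail D e)), head = (\<lambda>e. c (head D e)) \<rparr>)"

definition scc_components ::
    "('v, 'e) pgraph \<Rightarrow> ('v, 'e) pre_digraph \<Rightarrow> ('v, 'e) component set" where
  "scc_components G D =
     {(C, {e \<in> arcs D. tail D e \<in> C}) | C.
        \<exists>S \<in> pre_digraph.sccs (contract_pinned G D). None \<notin> verts S \<and> verts S = Some ` C}"

definition scc_above ::
    "('v, 'e) pre_digraph \<Rightarrow> ('v, 'e) component \<Rightarrow> ('v, 'e) component \<Rightarrow> bool" where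
  "scc_above D A B \<longleftrightarrow> (\<exists>e\<in>arcs D. tail D e \<in> fst A \<and> head D e \<in> fst B)"

text \<open>\<open>A\<close> is lower block-triangular with square diagonal blocks of the sizes listed in \<open>ns\<close>:
  all entries in a row block \<open>\<le> k\<close> and a column block \<open>> k\<close> vanish.\<close>

definition lower_block_triangular :: "nat list \<Rightarrow> real mat \<Rightarrow> bool" where
  "lower_block_triangular ns A \<longleftrightarrow> A \<in> carrier_mat (sum_list ns) (sum_list ns) \<and>
     (\<forall>k < length ns. \<forall>i j. i < sum_list (take (Suc k) ns) \<longrightarrow>
        sum_list (take (Suc k) ns) \<le> j \<longrightarrow> j < sum_list ns \<longrightarrow> A $$ (i, j) = 0)"

text \<open>A permuted matrix with its subdivision is given by the list of blocks, each with its inner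
  vertices (columns) and edges (rows) in order; empty blocks are excluded.\<close>

definition block_decomposition ::
    "nat \<Rightarrow> ('v, 'e) pgraph \<Rightarrow> ('v \<Rightarrow> real vec) \<Rightarrow> ('v list \<times> 'e list) list \<Rightarrow> bool" where
  "block_decomposition d G p bs \<longleftrightarrow>
     enumerates (concat (map fst bs)) (inner_verts G) \<and>
     enumerates (concat (map snd bs)) (edges G) \<and>
     (\<forall>b\<in>set bs. fst b \<noteq> [] \<and> length (snd b) = d * length (fst b)) \<and>
     lower_block_triangular (map (\<lambda>b. length (snd b)) bs)
       (rigidity_matrix d G p (concat (map snd bs)) (concat (map fst bs)))"

definition max_block_decomposition ::
    "nat \<Rightarrow> ('v, 'e) pgraph \<Rightarrow> ('v \<Rightarrow> real vec) \<Rightarrow> ('v list \<times> 'e list) list \<Rightarrow> bool" where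
  "max_block_decomposition d G p bs \<longleftrightarrow> block_decomposition d G p bs \<and>
     (\<forall>bs'. block_decomposition d G p bs' \<longrightarrow> length bs' \<le> length bs)"

definition block_component :: "'v list \<times> 'e list \<Rightarrow> ('v, 'e) component" where
  "block_component b = (set (fst b), set (snd b))"

definition block_components :: "('v list \<times> 'e list) list \<Rightarrow> ('v, 'e) component set" where
  "block_components bs = block_component ` set bs"

definition block_above ::
    "nat \<Rightarrow> ('v, 'e) pgraph \<Rightarrow> ('v \<Rightarrow> real vec) \<Rightarrow>
     ('v, 'e) component \<Rightarrow> ('v, 'e) component \<Rightarrow> bool" where
  "block_above d G p A B \<longleftrightarrow>
     (\<exists>e\<in>snd A. \<exists>v\<in>fst B. rigidity_entries d G p e v \<noteq> 0\<^sub>v d)"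

text \<open>The linear order of the blocks extends the partial order \<open>r\<close>: what lies below comes first,
  as suits a lower triangular matrix.\<close>

definition block_order_extends ::
    "('v list \<times> 'e list) list \<Rightarrow> (('v, 'e) component \<times> ('v, 'e) component) set \<Rightarrow> bool" where
  "block_order_extends bs r \<longleftrightarrow>
     (\<forall>i < length bs. \<forall>j < length bs.
        (block_component (bs ! i), block_component (bs ! j)) \<in> r \<longrightarrow> j \<le> i)"

end

theory Submission
  imports Defs
begin

text \<open>Call a set \<open>J\<close> of inner vertices closed if no edge directed out of \<open>J\<close> leaves
  \<open>J\<close> and the pinned vertices. Exactly \<open>d * card J\<close> edges are directed out of \<open>J\<close>,
  so a square block of the rigidity matrix on top of a closed ground must consist of all edges
  directed out of its vertices, and the ground stays closed when these are added. Conversely, the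
  zero pattern makes every difference of closed sets isostatic. All three decompositions are
  therefore finest chains of closed sets, whose successive differences are the strong components.
  The orientation itself is a nonvanishing term of the Leibniz expansion of the determinant.\<close>

subsection \<open>Nonsingular matrices with arbitrary index sets\<close>

text \<open>Splitting a closed ground off a larger closed set is done without block determinants:
  independent rows stay independent when restricted to columns outside of which they vanish. This
  handles one side of the triangular shape only; the other side is reached by transposing, and each
  transposition needs a square block, which the out-degree count supplies. Independence is therefore
  phrased for functions on sets, free of any order of rows and columns, and lists appear only where
  the definitions speak of matrices. A single configuration serves all layers: entries depend on a
  graph only through \<open>ends\<close>, so a \<open>p\<close> that is nonsingular for the whole
  graph is a witness for each layer. Nonsingularity also makes the entry vector at every incidence
  nonzero, so that block decompositions become a matter of incidence alone. Maximality is settled by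
  counting: a complete Assur run, read as a list of blocks, attains the upper bound given by the
  number of strong components.\<close>

definition rows_indep :: "('a \<Rightarrow> 'b \<Rightarrow> real) \<Rightarrow> 'a set \<Rightarrow> 'b set \<Rightarrow> bool" where
  "rows_indep M A B \<longleftrightarrow>
     (\<forall>y. (\<forall>b\<in>B. (\<Sum>a\<in>A. y a * M a b) = 0) \<longrightarrow> (\<forall>a\<in>A. y a = 0))"

lemma rows_indepD:
  assumes "rows_indep M A B" "\<And>b. b \<in> B \<Longrightarrow> (\<Sum>a\<in>A. y a * M a b) = 0" "a \<in> A"
  shows "y a = 0"
  using assms unfolding rows_indep_def by blast

text \<open>Extending \<open>y\<close> by zero turns a dependency of the rows in \<open>A'\<close>
  into one of all rows: columns in \<open>B'\<close> satisfy it by assumption, and in the other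
  columns of \<open>B\<close> the rows of \<open>A'\<close> vanish.\<close>

lemma rows_indep_subset:
  assumes ind: "rows_indep M A B" and fin: "finite A" and sub: "A' \<subseteq> A"
    and zero: "\<And>a b. a \<in> A' \<Longrightarrow> b \<in> B - B' \<Longrightarrow> M a b = 0"
  shows "rows_indep M A' B'"
  unfolding rows_indep_def
proof (intro allI impI ballI)
  fix y a assume y: "\<forall>b\<in>B'. (\<Sum>a\<in>A'. y a * M a b) = 0" and a: "a \<in> A'"
  define z where "z a = (if a \<in> A' then y a else 0)" for a
  have "(\<Sum>a\<in>A. z a * M a b) = 0" if "b \<in> B" for b
  proof -
    have "(\<Sum>a\<in>A. z a * M a b) = (\<Sum>a\<in>A'. y a * M a b)"
      using fin sub by (intro sum.mono_neutral_cong_right) (auto simp: z_def)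
    also have "\<dots> = 0"
    proof (cases "b \<in> B'")
      case False
      then show ?thesis using zero that by (intro sum.neutral) auto
    qed (use y in simp)
    finally show ?thesis .
  qed
  then have "z a = 0" using rows_indepD[OF ind] a sub by blast
  then show "y a = 0" using a by (simp add: z_def)
qed

definition list_mat :: "('a \<Rightarrow> 'b \<Rightarrow> real) \<Rightarrow> 'a list \<Rightarrow> 'b list \<Rightarrow> real mat" where
  "list_mat M as bs = mat (length as) (length bs) (\<lambda>(i, j). M (as ! i) (bs ! j))"

lemma list_mat_carrier: "list_mat M as bs \<in> carrier_mat (length as) (length bs)"
  by (simp add: list_mat_def)

lemma transpose_list_mat: "transpose_mat (list_mat M as bs) = list_mat (\<lambda>b a. M a b) bs as"
  by (rule eq_matI) (auto simp: list_mat_def)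

lemma sum_nth_eq_sum_set:
  assumes "distinct as"
  shows "(\<Sum>i = 0..<length as. f (as ! i)) = sum f (set as)"
  using sum.reindex_bij_betw[OF bij_betw_nth[OF assms refl refl], of f]
  by (simp add: lessThan_atLeast0)

text \<open>Coefficient functions on \<open>set as\<close> correspond to vectors in the kernel of
  the transpose. The right-hand side mentions only sets, so whether the determinant vanishes does
  not depend on the order of rows and columns.\<close>

lemma det_list_mat_iff_rows_indep:
  assumes as: "distinct as" and bs: "distinct bs" and len: "length as = length bs"
  shows "det (list_mat M as bs) \<noteq> 0 \<longleftrightarrow> rows_indep M (set as) (set bs)"
proof -
  let ?n = "length as" and ?T = "transpose_mat (list_mat M as bs)"
  have C: "list_mat M as bs \<in> carrier_mat ?n ?n"
    using list_mat_carrier[of M as bs] len by simp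
  have T: "?T \<in> carrier_mat ?n ?n" using C by simp
  have mult: "(?T *\<^sub>v v) $ j = (\<Sum>i = 0..<?n. v $ i * M (as ! i) (bs ! j))"
    if "v \<in> carrier_vec ?n" "j < ?n" for v j
    using that len unfolding transpose_list_mat
    by (auto simp: list_mat_def scalar_prod_def mult.commute intro!: sum.cong)
  have "det (list_mat M as bs) = 0 \<longleftrightarrow>
      (\<exists>v. v \<in> carrier_vec ?n \<and> v \<noteq> 0\<^sub>v ?n \<and> ?T *\<^sub>v v = 0\<^sub>v ?n)"
    using det_0_iff_vec_prod_zero[OF T] det_transpose[OF C] by simp
  also have "\<dots> \<longleftrightarrow> \<not> rows_indep M (set as) (set bs)"
  proof
    assume "\<exists>v. v \<in> carrier_vec ?n \<and> v \<noteq> 0\<^sub>v ?n \<and> ?T *\<^sub>v v = 0\<^sub>v ?n"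
    then obtain v where v: "v \<in> carrier_vec ?n" "v \<noteq> 0\<^sub>v ?n" "?T *\<^sub>v v = 0\<^sub>v ?n" by blast
    define y where "y a = v $ (THE i. i < ?n \<and> as ! i = a)" for a
    have y: "y (as ! i) = v $ i" if "i < ?n" for i
    proof -
      have "(THE j. j < ?n \<and> as ! j = as ! i) = i"
        using that as by (intro the_equality) (auto simp: nth_eq_iff_index_eq)
      then show ?thesis by (simp add: y_def)
    qed
    have "(\<Sum>a\<in>set as. y a * M a b) = 0" if b: "b \<in> set bs" for b
    proof -
      from b obtain j where j: "j < ?n" "b = bs ! j" using len by (metis in_set_conv_nth)
      have "(\<Sum>a\<in>set as. y a * M a b) = (\<Sum>i = 0..<?n. y (as ! i) * M (as ! i) b)"
        using sum_nth_eq_sum_set[OF as, of "\<lambda>a. y a * M a b"] by simp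
      also have "\<dots> = (?T *\<^sub>v v) $ j" using mult[OF v(1) j(1)] j(2) by (simp add: y)
      finally show ?thesis using v(3) j by simp
    qed
    moreover obtain i where "i < ?n" "v $ i \<noteq> 0" using v(1,2) by (auto simp: vec_eq_iff)
    ultimately show "\<not> rows_indep M (set as) (set bs)"
      using rows_indepD[of M "set as" "set bs" y "as ! i"] y by auto
  next
    assume "\<not> rows_indep M (set as) (set bs)"
    then obtain y a where y: "\<forall>b\<in>set bs. (\<Sum>a\<in>set as. y a * M a b) = 0" "a \<in> set as" "y a \<noteq> 0"
      unfolding rows_indep_def by blast
    define v where "v = vec ?n (\<lambda>i. y (as ! i))"
    have v: "v \<in> carrier_vec ?n" by (simp add: v_def)
    have "?T *\<^sub>v v = 0\<^sub>v ?n"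
    proof (rule eq_vecI)
      fix j assume "j < dim_vec (0\<^sub>v ?n :: real vec)"
      then have j: "j < ?n" by simp
      have "(?T *\<^sub>v v) $ j = (\<Sum>a\<in>set as. y a * M a (bs ! j))"
        using mult[OF v j] sum_nth_eq_sum_set[OF as, of "\<lambda>a. y a * M a (bs ! j)"] by (simp add: v_def)
      then show "(?T *\<^sub>v v) $ j = 0\<^sub>v ?n $ j" using y(1) j len by simp
    qed (use T in simp)
    moreover have "v \<noteq> 0\<^sub>v ?n"
    proof -
      obtain i where "i < ?n" "a = as ! i" using y(2) by (metis in_set_conv_nth)
      then have "v $ i \<noteq> 0\<^sub>v ?n $ i" using y(3) by (simp add: v_def)
      then show ?thesis by metis
    qed
    ultimately show "\<exists>v. v \<in> carrier_vec ?n \<and> v \<noteq> 0\<^sub>v ?n \<and> ?T *\<^sub>v v = 0\<^sub>v ?n" using v by blast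
  qed
  finally show ?thesis by blast
qed

text \<open>The array is square, so both independence statements say that a determinant is nonzero,
  that of a matrix or that of its transpose.\<close>

lemma rows_indep_transpose:
  assumes "finite A" "finite B" "card A = card B" "rows_indep M A B"
  shows "rows_indep (\<lambda>b a. M a b) B A"
proof -
  obtain as bs where as: "set as = A" "distinct as" and bs: "set bs = B" "distinct bs"
    using assms(1,2) finite_distinct_list by metis
  then have len: "length as = length bs" using assms(3) by (metis distinct_card)
  have "list_mat M as bs \<in> carrier_mat (length as) (length as)"
    using list_mat_carrier[of M as bs] len by simp
  then have "det (list_mat (\<lambda>b a. M a b) bs as) = det (list_mat M as bs)"
    using det_transpose by (metis transpose_list_mat)
  then show ?thesis
    using det_list_mat_iff_rows_indep[OF as(2) bs(2) len, of M]
      det_list_mat_iff_rows_indep[OF bs(2) as(2) len[symmetric], of "\<lambda>b a. M a b"] assms(4) as(1) bs(1)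
    by simp
qed

lemma rows_indep_imp_bij_betw:
  assumes "finite A" "finite B" "card A = card B" "rows_indep M A B"
  obtains \<sigma> where "bij_betw \<sigma> A B" "\<And>a. a \<in> A \<Longrightarrow> M a (\<sigma> a) \<noteq> 0"
proof -
  obtain as bs where as: "set as = A" "distinct as" and bs: "set bs = B" "distinct bs"
    using assms(1,2) finite_distinct_list by metis
  then have len: "length as = length bs" using assms(3) by (metis distinct_card)
  let ?n = "length as"
  have C: "list_mat M as bs \<in> carrier_mat ?n ?n"
    using list_mat_carrier[of M as bs] len by simp
  have "det (list_mat M as bs) \<noteq> 0"
    using det_list_mat_iff_rows_indep[OF as(2) bs(2) len] assms(4) as bs by simp
  then obtain \<pi> where \<pi>: "\<pi> permutes {0..<?n}"
      and nz: "(\<Prod>i = 0..<?n. list_mat M as bs $$ (i, \<pi> i)) \<noteq> 0"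
    unfolding det_def'[OF C] by (metis (no_types, lifting) mem_Collect_eq mult_zero_right sum.not_neutral_contains_not_neutral)
  have f: "bij_betw ((!) as) {0..<?n} A" and g: "bij_betw ((!) bs) {0..<?n} B"
    using bij_betw_nth[OF as(2)] bij_betw_nth[OF bs(2)] as(1) bs(1) len by (auto simp: lessThan_atLeast0)
  define \<sigma> where "\<sigma> = (!) bs \<circ> \<pi> \<circ> inv_into {0..<?n} ((!) as)"
  show ?thesis
  proof
    show "bij_betw \<sigma> A B" unfolding \<sigma>_def
      using bij_betw_inv_into[OF f] permutes_imp_bij[OF \<pi>] g by (blast intro: bij_betw_trans)
    fix a assume "a \<in> A"
    then have i: "inv_into {0..<?n} ((!) as) a \<in> {0..<?n}" and ai: "as ! inv_into {0..<?n} ((!) as) a = a"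
      using f by (auto simp: bij_betw_def intro: inv_into_into f_inv_into_f)
    let ?i = "inv_into {0..<?n} ((!) as) a"
    have "list_mat M as bs $$ (?i, \<pi> ?i) \<noteq> 0" using nz i by (metis finite_atLeastLessThan prod_zero)
    moreover have "\<pi> ?i \<in> {0..<?n}" using \<pi> i by (simp add: permutes_in_image)
    ultimately show "M a (\<sigma> a) \<noteq> 0" using i ai len by (simp add: list_mat_def \<sigma>_def)
  qed
qed

lemma invertible_mat_iff_det:
  fixes A :: "real mat"
  assumes "A \<in> carrier_mat n n"
  shows "invertible_mat A \<longleftrightarrow> det A \<noteq> 0"
proof
  assume "invertible_mat A"
  then obtain B where B: "inverts_mat A B" "inverts_mat B A" unfolding invertible_mat_def by blast
  have "B \<in> carrier_mat n n" using B assms unfolding inverts_mat_def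
    by (metis carrier_matD(1) carrier_matD(2) carrier_mat_triv index_mult_mat(2) index_mult_mat(3) index_one_mat(2) index_one_mat(3))
  then have "det A * det B = 1"
    using B(1) det_mult[OF assms, of B] assms by (simp add: inverts_mat_def)
  then show "det A \<noteq> 0" by auto
next
  assume "det A \<noteq> 0"
  from det_non_zero_imp_unit[OF assms this] obtain B where "B \<in> carrier_mat n n" "B * A = 1\<^sub>m n" "A * B = 1\<^sub>m n"
    unfolding Units_def ring_mat_def by auto
  then show "invertible_mat A" using assms unfolding invertible_mat_def inverts_mat_def by auto
qed

subsection \<open>The rigidity matrix\<close>

text \<open>A column is a pair of an inner vertex and a coordinate. The columns belonging to a
  vertex set \<open>J\<close> are then simply \<open>J \<times> {..<d}\<close>, and moving a vertex
  moves its \<open>d\<close> columns together.\<close>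

definition rigidity_coeff ::
    "nat \<Rightarrow> ('v, 'e) pgraph \<Rightarrow> ('v \<Rightarrow> real vec) \<Rightarrow> 'e \<Rightarrow> 'v \<times> nat \<Rightarrow> real" where
  "rigidity_coeff d G p e c = rigidity_entries d G p e (fst c) $ snd c"

text \<open>Only independence of the rows is recorded. Invertibility is this together with the count
  \<open>card (edges G) = d * card (inner_verts G)\<close>; for a layer the count comes from the
  orientation.\<close>

definition nonsingular :: "nat \<Rightarrow> ('v, 'e) pgraph \<Rightarrow> ('v \<Rightarrow> real vec) \<Rightarrow> bool" where
  "nonsingular d G p \<longleftrightarrow>
     rows_indep (rigidity_coeff d G p) (edges G) (inner_verts G \<times> {..<d})"

text \<open>\<open>List.product vs [0..<d]\<close> runs through all coordinates of one vertex before
  passing to the next, so position \<open>c\<close> holds the vertex \<open>vs ! (c div d)\<close>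
  with coordinate \<open>c mod d\<close>.\<close>

lemma rigidity_matrix_eq_list_mat:
  "rigidity_matrix d G p es vs = list_mat (rigidity_coeff d G p) es (List.product vs [0..<d])"
proof (rule eq_matI)
  fix i j
  assume "i < dim_row (list_mat (rigidity_coeff d G p) es (List.product vs [0..<d]))"
    "j < dim_col (list_mat (rigidity_coeff d G p) es (List.product vs [0..<d]))"
  then have ij: "i < length es" "j < length vs * d" by (auto simp: list_mat_def)
  then have "j mod d < d" by (cases "d = 0") auto
  moreover have "List.product vs [0..<d] ! j = (vs ! (j div d), [0..<d] ! (j mod d))"
    using product_nth[of j vs "[0..<d]"] ij by simp
  ultimately show "rigidity_matrix d G p es vs $$ (i, j) =
      list_mat (rigidity_coeff d G p) es (List.product vs [0..<d]) $$ (i, j)"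
    using ij by (simp add: rigidity_matrix_def list_mat_def rigidity_coeff_def mult.commute)
qed (auto simp: rigidity_matrix_def list_mat_def)

lemma rigidity_matrix_carrier:
  "rigidity_matrix d G p es vs \<in> carrier_mat (length es) (d * length vs)"
  by (simp add: rigidity_matrix_def)

lemma det_rigidity_matrix_iff_nonsingular:
  assumes es: "enumerates es (edges G)" and vs: "enumerates vs (inner_verts G)"
    and len: "length es = d * length vs"
  shows "det (rigidity_matrix d G p es vs) \<noteq> 0 \<longleftrightarrow> nonsingular d G p"
proof -
  have "set (List.product vs [0..<d]) = inner_verts G \<times> {..<d}"
    using vs by (auto simp: enumerates_def)
  moreover have "distinct (List.product vs [0..<d])"
    using vs by (simp add: enumerates_def distinct_product)
  moreover have "length es = length (List.product vs [0..<d])" using len by simp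
  ultimately show ?thesis
    using det_list_mat_iff_rows_indep[of es "List.product vs [0..<d]" "rigidity_coeff d G p"] es
    unfolding rigidity_matrix_eq_list_mat nonsingular_def enumerates_def by simp
qed

section \<open>Isostaticity and genericity without enumerations\<close>

lemma enumerates_length: "enumerates xs A \<Longrightarrow> length xs = card A"
  by (auto simp: enumerates_def distinct_card)

lemma enumerates_exists: "finite A \<Longrightarrow> \<exists>xs. enumerates xs A"
  using finite_distinct_list unfolding enumerates_def by metis

lemma pinned_isostatic_iff:
  "pinned_isostatic d G \<longleftrightarrow> pinned_graph G \<and> card (edges G) = d * card (inner_verts G) \<and>
     (\<exists>p. configuration d G p \<and> nonsingular d G p)"
proof
  assume "pinned_isostatic d G"
  then obtain p es vs where *: "pinned_graph G" "configuration d G p"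
      "enumerates es (edges G)" "enumerates vs (inner_verts G)"
      "invertible_mat (rigidity_matrix d G p es vs)"
    unfolding pinned_isostatic_def by blast
  \<comment> \<open>Squareness is part of \<open>invertible_mat\<close>; this is the source of the
    edge count.\<close>
  have len: "length es = d * length vs"
    using *(5) rigidity_matrix_carrier[of d G p es vs] by (simp add: invertible_mat_def)
  then have "nonsingular d G p"
    using * det_rigidity_matrix_iff_nonsingular invertible_mat_iff_det rigidity_matrix_carrier by metis
  with * len show "pinned_graph G \<and> card (edges G) = d * card (inner_verts G) \<and>
     (\<exists>p. configuration d G p \<and> nonsingular d G p)"
    using enumerates_length by metis
next
  assume R: "pinned_graph G \<and> card (edges G) = d * card (inner_verts G) \<and>
     (\<exists>p. configuration d G p \<and> nonsingular d G p)"
  then obtain p where p: "configuration d G p" "nonsingular d G p" by blast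
  from R obtain es vs where ev: "enumerates es (edges G)" "enumerates vs (inner_verts G)"
    using enumerates_exists unfolding pinned_graph_def by metis
  then have len: "length es = d * length vs" using R enumerates_length by metis
  then have "invertible_mat (rigidity_matrix d G p es vs)"
    using det_rigidity_matrix_iff_nonsingular[OF ev len] p invertible_mat_iff_det
      rigidity_matrix_carrier by metis
  then show "pinned_isostatic d G" using R p ev unfolding pinned_isostatic_def by blast
qed

text \<open>The configuration witnessing isostaticity has full rank, which no matrix of this size
  exceeds. A generic \<open>p\<close> has at least that rank, and a square matrix of full rank has
  nonzero determinant.\<close>

lemma generic_imp_nonsingular:
  assumes "pinned_isostatic d G" "generic d G p"
  shows "nonsingular d G p"
proof -
  obtain q where q: "configuration d G q" "nonsingular d G q"
    and G: "pinned_graph G" "card (edges G) = d * card (inner_verts G)"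
    using assms(1) unfolding pinned_isostatic_iff by blast
  from G obtain es vs where ev: "enumerates es (edges G)" "enumerates vs (inner_verts G)"
    using enumerates_exists unfolding pinned_graph_def by metis
  then have len: "length es = d * length vs" using G enumerates_length by metis
  let ?n = "length es"
  have C: "rigidity_matrix d G r es vs \<in> carrier_mat ?n ?n" for r
    using rigidity_matrix_carrier[of d G r es vs] len by simp
  have "vec_space.rank ?n (rigidity_matrix d G q es vs) = ?n"
    using det_rigidity_matrix_iff_nonsingular[OF ev len] q vec_space.det_rank_iff[OF C] by blast
  then have "?n \<le> vec_space.rank ?n (rigidity_matrix d G p es vs)"
    using assms(2) ev q(1) unfolding generic_def by metis
  moreover have "vec_space.rank ?n (rigidity_matrix d G p es vs) \<le> ?n"
    using vec_space.rank_le_nc[OF C] by simp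
  ultimately have "vec_space.rank ?n (rigidity_matrix d G p es vs) = ?n" by simp
  then show ?thesis
    using det_rigidity_matrix_iff_nonsingular[OF ev len] vec_space.det_rank_iff[OF C] by blast
qed

section \<open>Zero pattern of the rigidity matrix\<close>

lemma card_2_obtain_other:
  assumes "card X = 2" "v \<in> X"
  obtains w where "X = {v, w}" "v \<noteq> w"
  using assms by (metis card_2_iff doubleton_eq_iff insert_iff singleton_iff)

lemma other_end_eqI:
  assumes "ends G e = {v, w}" "v \<noteq> w"
  shows "other_end G e v = w"
  unfolding other_end_def using assms by (intro the_equality) auto

lemma rigidity_entries_carrier:
  assumes "pinned_graph G" "configuration d G p" "e \<in> edges G"
  shows "rigidity_entries d G p e v \<in> carrier_vec d"
proof (cases "v \<in> ends G e")
  case True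
  from assms(1,3) have "card (ends G e) = 2" and sub: "ends G e \<subseteq> inner_verts G \<union> pinned_verts G"
    by (auto simp: pinned_graph_def)
  then obtain w where w: "ends G e = {v, w}" "v \<noteq> w"
    using True card_2_obtain_other by metis
  then show ?thesis
    using sub assms(2) True by (auto simp: rigidity_entries_def other_end_eqI[OF w] configuration_def)
qed (simp add: rigidity_entries_def)

text \<open>If an edge had coinciding end points, its whole row would vanish.\<close>

lemma rigidity_entries_eq_0_iff:
  assumes G: "pinned_graph G" and p: "configuration d G p" "nonsingular d G p" and e: "e \<in> edges G"
  shows "rigidity_entries d G p e v = 0\<^sub>v d \<longleftrightarrow> v \<notin> ends G e"
proof
  assume zero: "rigidity_entries d G p e v = 0\<^sub>v d"
  show "v \<notin> ends G e"
  proof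
    assume v: "v \<in> ends G e"
    from G e have "card (ends G e) = 2" and sub: "ends G e \<subseteq> inner_verts G \<union> pinned_verts G"
      and fin: "finite (edges G)" by (auto simp: pinned_graph_def)
    then obtain w where w: "ends G e = {v, w}" "v \<noteq> w"
      using v card_2_obtain_other by metis
    have carr: "p v \<in> carrier_vec d" "p w \<in> carrier_vec d"
      using w sub p(1) by (auto simp: configuration_def)
    have "p v - p w = 0\<^sub>v d" using zero v by (simp add: rigidity_entries_def other_end_eqI[OF w])
    then have pvw: "p v = p w"
      using carr by (auto simp: vec_eq_iff)
    have "rigidity_coeff d G p e c = 0" if "c \<in> inner_verts G \<times> {..<d}" for c
    proof -
      obtain u k where c: "c = (u, k)" "k < d" using \<open>c \<in> _\<close> by auto
      have "ends G e = {w, v}" "w \<noteq> v" using w by auto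
      from other_end_eqI[OF this] other_end_eqI[OF w] show ?thesis
        using w c carr pvw by (auto simp: rigidity_coeff_def rigidity_entries_def)
    qed
    then have "(\<Sum>a\<in>edges G. (if a = e then 1 else 0) * rigidity_coeff d G p a c) = 0"
      if "c \<in> inner_verts G \<times> {..<d}" for c
      using that by (intro sum.neutral) auto
    from rows_indepD[OF p(2)[unfolded nonsingular_def] this e] show False by simp
  qed
qed (simp add: rigidity_entries_def)

lemma rigidity_coeff_eq_0: "v \<notin> ends G e \<Longrightarrow> k < d \<Longrightarrow> rigidity_coeff d G p e (v, k) = 0"
  by (simp add: rigidity_coeff_def rigidity_entries_def)

section \<open>Existence of an orientation\<close>

lemma directed_orientation_exists:
  assumes "pinned_isostatic d G"
  shows "\<exists>D. directed_orientation d G D"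
proof -
  let ?I = "inner_verts G" and ?E = "edges G"
  from assms obtain p where G: "pinned_graph G" "card ?E = d * card ?I"
    and p: "configuration d G p" "nonsingular d G p"
    unfolding pinned_isostatic_iff by blast
  have fin: "finite ?E" "finite ?I" and dis: "?I \<inter> pinned_verts G = {}"
    using G by (auto simp: pinned_graph_def)
  \<comment> \<open>Each edge is matched with one column \<open>(v, k)\<close> where its entry is
    nonzero. So \<open>v\<close> is an end of the edge and can serve as its tail. It receives one
    edge for each of its \<open>d\<close> columns, while pinned vertices, having no columns, receive
    none.\<close>
  obtain \<sigma> where \<sigma>: "bij_betw \<sigma> ?E (?I \<times> {..<d})"
    and nz: "\<And>e. e \<in> ?E \<Longrightarrow> rigidity_coeff d G p e (\<sigma> e) \<noteq> 0"
    using rows_indep_imp_bij_betw[OF fin(1) _ _ p(2)[unfolded nonsingular_def]] fin G(2)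
    by (metis card_cartesian_product card_lessThan finite_SigmaI finite_lessThan mult.commute)
  have tl: "fst (\<sigma> e) \<in> ends G e" "fst (\<sigma> e) \<in> ?I" "snd (\<sigma> e) < d" if "e \<in> ?E" for e
  proof -
    have s: "\<sigma> e \<in> ?I \<times> {..<d}" using \<sigma> that by (auto simp: bij_betw_def)
    then show "fst (\<sigma> e) \<in> ?I" "snd (\<sigma> e) < d" by auto
    then show "fst (\<sigma> e) \<in> ends G e"
      using nz[OF that] rigidity_coeff_eq_0[of "fst (\<sigma> e)" G e "snd (\<sigma> e)" d p] by auto
  qed
  define D where "D = \<lparr>verts = ?I \<union> pinned_verts G, arcs = ?E,
    tail = (\<lambda>e. fst (\<sigma> e)), head = (\<lambda>e. other_end G e (fst (\<sigma> e)))\<rparr>"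
  have "directed_orientation d G D"
    unfolding directed_orientation_def
  proof (intro conjI ballI)
    fix e assume e: "e \<in> ?E"
    then have "card (ends G e) = 2" using G(1) by (simp add: pinned_graph_def)
    then obtain w where w: "ends G e = {fst (\<sigma> e), w}" "fst (\<sigma> e) \<noteq> w"
      using tl(1)[OF e] card_2_obtain_other by metis
    then show "ends G e = {tail D e, head D e}" by (simp add: D_def other_end_eqI)
  next
    fix v assume v: "v \<in> ?I"
    have "bij_betw \<sigma> {e \<in> ?E. fst (\<sigma> e) = v} ({v} \<times> {..<d})"
      unfolding bij_betw_def
    proof
      show "inj_on \<sigma> {e \<in> ?E. fst (\<sigma> e) = v}" using \<sigma> by (auto simp: bij_betw_def inj_on_def)
      show "\<sigma> ` {e \<in> ?E. fst (\<sigma> e) = v} = {v} \<times> {..<d}"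
      proof (intro equalityI subsetI)
        fix c assume "c \<in> {v} \<times> {..<d}"
        then have "c \<in> \<sigma> ` ?E" "fst c = v" using \<sigma> v by (auto simp: bij_betw_def)
        then show "c \<in> \<sigma> ` {e \<in> ?E. fst (\<sigma> e) = v}" by auto
      qed (use tl in \<open>auto simp: mem_Times_iff\<close>)
    qed
    then have "card {e \<in> ?E. fst (\<sigma> e) = v} = d" by (simp add: bij_betw_same_card)
    then show "out_degree D v = d" by (simp add: out_degree_def out_arcs_def D_def)
  next
    fix v assume "v \<in> pinned_verts G"
    then have none: "{e \<in> ?E. fst (\<sigma> e) = v} = {}" using tl(2) dis by auto
    show "out_degree D v = 0" unfolding out_degree_def out_arcs_def D_def by (simp add: none)
  qed (auto simp: D_def)
  then show ?thesis by blast
qed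

subsection \<open>Closed sets of an orientation\<close>

text \<open>The configuration is left to the individual lemmas, so that an orientation can be
  combined with any nonsingular \<open>p\<close>: a witness of isostaticity when runs are completed,
  a generic one when the decompositions are compared.\<close>

locale oriented_pinned_graph =
  fixes d :: nat and G :: "('v, 'e) pgraph" and D :: "('v, 'e) pre_digraph"
  assumes pinned_graph: "pinned_graph G" and orientation: "directed_orientation d G D"
begin

abbreviation "I \<equiv> inner_verts G"
abbreviation "P \<equiv> pinned_verts G"
abbreviation "E \<equiv> edges G"

lemma finite_graph: "finite I" "finite P" "finite E"
  using pinned_graph by (auto simp: pinned_graph_def)

lemma inner_pinned_disjoint: "I \<inter> P = {}"
  using pinned_graph by (auto simp: pinned_graph_def)

lemma arcs_eq: "arcs D = E"
  using orientation by (simp add: directed_orientation_def)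

lemma ends_eq: "e \<in> E \<Longrightarrow> ends G e = {tail D e, head D e}"
  using orientation by (simp add: directed_orientation_def)

lemma ends_subset: "e \<in> E \<Longrightarrow> ends G e \<subseteq> I \<union> P"
  using pinned_graph by (simp add: pinned_graph_def)

lemma tail_in_inner:
  assumes "e \<in> E"
  shows "tail D e \<in> I"
proof (rule ccontr)
  assume "tail D e \<notin> I"
  then have "tail D e \<in> P" using ends_subset[OF assms] ends_eq[OF assms] by auto
  then have "card (out_arcs D (tail D e)) = 0"
    using orientation by (simp add: directed_orientation_def out_degree_def)
  moreover have "finite (out_arcs D (tail D e))"
    using finite_graph(3) by (simp add: out_arcs_def arcs_eq)
  moreover have "e \<in> out_arcs D (tail D e)" using assms by (simp add: out_arcs_def arcs_eq)
  ultimately show False by auto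
qed

definition out :: "'v set \<Rightarrow> 'e set" where
  "out J = {e \<in> E. tail D e \<in> J}"

lemma out_subset: "out J \<subseteq> E"
  by (auto simp: out_def)

lemma finite_out: "finite (out J)"
  using finite_graph(3) out_subset finite_subset by blast

lemma card_out:
  assumes "J \<subseteq> I"
  shows "card (out J) = d * card J"
proof -
  have fin: "finite J" using assms finite_graph(1) finite_subset by blast
  have "out J = (\<Union>v\<in>J. out_arcs D v)" by (auto simp: out_def out_arcs_def arcs_eq)
  also have "card \<dots> = (\<Sum>v\<in>J. card (out_arcs D v))"
    using fin finite_graph(3) by (intro card_UN_disjoint) (auto simp: out_arcs_def arcs_eq)
  also have "\<dots> = (\<Sum>v\<in>J. d)"
    using assms orientation by (intro sum.cong) (auto simp: directed_orientation_def out_degree_def)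
  finally show ?thesis by simp
qed

definition down_closed :: "'v set \<Rightarrow> bool" where
  "down_closed J \<longleftrightarrow> J \<subseteq> I \<and> (\<forall>e\<in>out J. ends G e \<subseteq> J \<union> P)"

lemma down_closed_empty: "down_closed {}"
  by (simp add: down_closed_def out_def)

lemma down_closed_inner: "down_closed I"
  using ends_subset by (auto simp: down_closed_def out_def)

lemma edges_eq_out:
  assumes "J \<subseteq> I" "F \<subseteq> E" "\<And>e. e \<in> F \<Longrightarrow> tail D e \<in> J" "card F = d * card J"
  shows "F = out J"
proof (rule card_subset_eq)
  show "F \<subseteq> out J" using assms by (auto simp: out_def)
  show "card F = card (out J)" using assms card_out by simp
qed (rule finite_out)

lemma down_closed_Un:
  assumes "down_closed K" "J \<subseteq> I" "\<And>e. e \<in> out J \<Longrightarrow> ends G e \<subseteq> K \<union> J \<union> P"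
  shows "down_closed (K \<union> J)"
  using assms by (auto simp: down_closed_def out_def)

subsection \<open>Strong components\<close>

lemma arcs_ends_iff: "(u, v) \<in> arcs_ends D \<longleftrightarrow> (\<exists>e\<in>E. u = tail D e \<and> v = head D e)"
  by (auto simp: arcs_ends_conv arcs_eq)

lemma reachable_head:
  "(u, tail D e) \<in> (arcs_ends D)\<^sup>* \<Longrightarrow> e \<in> E \<Longrightarrow> (u, head D e) \<in> (arcs_ends D)\<^sup>*"
  by (rule rtrancl_into_rtrancl) (auto simp: arcs_ends_iff)

text \<open>Pinned vertices have no outgoing edges, so a walk that leaves \<open>K\<close> ends at
  once, in a pinned vertex.\<close>

lemma reachable_down_closed:
  assumes "down_closed K" "u \<in> K" "(u, v) \<in> (arcs_ends D)\<^sup>*"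
  shows "v \<in> K \<union> P"
  using assms(3)
proof induction
  case base
  then show ?case using assms(2) by simp
next
  case (step x y)
  then obtain e where e: "e \<in> E" "x = tail D e" "y = head D e" by (auto simp: arcs_ends_iff)
  then have "e \<in> out K" using step.IH tail_in_inner[of e] inner_pinned_disjoint by (auto simp: out_def)
  then show ?case using assms(1) e ends_eq[of e] by (auto simp: down_closed_def)
qed

lemma reachable_from_inner: "(u, v) \<in> (arcs_ends D)\<^sup>* \<Longrightarrow> v \<in> I \<Longrightarrow> u \<in> I"
  by (erule converse_rtranclE) (auto simp: arcs_ends_iff tail_in_inner)

text \<open>Reachability is taken in \<open>D\<close> itself. Pinned vertices are sinks, so
  identifying them creates no new walk between inner vertices, and for inner \<open>v\<close> this
  is also the strong component in the contracted digraph.\<close>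

definition scc :: "'v \<Rightarrow> 'v set" where
  "scc v = {u. (u, v) \<in> (arcs_ends D)\<^sup>* \<and> (v, u) \<in> (arcs_ends D)\<^sup>*}"

lemma scc_self: "v \<in> scc v"
  by (simp add: scc_def)

lemma scc_eq: "u \<in> scc v \<Longrightarrow> scc u = scc v"
  unfolding scc_def by (auto intro: rtrancl_trans)

lemma scc_subset_inner: "v \<in> I \<Longrightarrow> scc v \<subseteq> I"
  unfolding scc_def using reachable_from_inner by blast

lemma scc_disjoint: "scc u \<noteq> scc v \<Longrightarrow> scc u \<inter> scc v = {}"
  using scc_eq by blast

text \<open>A vertex reachable from \<open>v\<close> stays in the larger closed set or is pinned.
  Were it in \<open>K\<close>, the walk back to \<open>v\<close> would keep \<open>v\<close> in
  \<open>K\<close> or the pinned vertices as well.\<close>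

lemma scc_subset_layer:
  assumes "down_closed K" "down_closed (K \<union> J)" "J \<inter> K = {}" "v \<in> J"
  shows "scc v \<subseteq> J"
proof
  fix u assume u: "u \<in> scc v"
  have vI: "v \<in> I" using assms by (auto simp: down_closed_def)
  then have uI: "u \<in> I" using u scc_subset_inner by blast
  have "u \<in> K \<union> J \<union> P" using reachable_down_closed[OF assms(2), of v u] u assms(4) by (auto simp: scc_def)
  moreover have "u \<notin> K"
  proof
    assume "u \<in> K"
    then have "v \<in> K \<union> P" using reachable_down_closed[OF assms(1), of u v] u by (auto simp: scc_def)
    then show False using vI assms(3,4) inner_pinned_disjoint by auto
  qed
  ultimately show "u \<in> J" using uI inner_pinned_disjoint by auto
qed

text \<open>For \<open>u\<close> in \<open>J\<close>, the inner vertices reachable from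
  \<open>u\<close> extend \<open>K\<close> to a closed set. What they add to \<open>K\<close> is a
  nonempty part of \<open>J\<close>, hence all of \<open>J\<close> by minimality; so any vertex of
  \<open>J\<close> reaches any other.\<close>

lemma minimal_layer_eq_scc:
  assumes K: "down_closed K" and KJ: "down_closed (K \<union> J)" and dis: "J \<inter> K = {}" and v: "v \<in> J"
    and min: "\<And>J'. J' \<noteq> {} \<Longrightarrow> J' \<subset> J \<Longrightarrow> \<not> down_closed (K \<union> J')"
  shows "J = scc v"
proof
  have reach: "(u, w) \<in> (arcs_ends D)\<^sup>*" if u: "u \<in> J" and w: "w \<in> J" for u w
  proof -
    define S where "S = {x \<in> I. (u, x) \<in> (arcs_ends D)\<^sup>*}"
    have "ends G e \<subseteq> S \<union> P" if "e \<in> out S" for e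
    proof -
      from that have e: "e \<in> E" "tail D e \<in> S" by (auto simp: out_def)
      then have "(u, head D e) \<in> (arcs_ends D)\<^sup>*"
        by (intro reachable_head) (auto simp: S_def)
      then show ?thesis using e ends_eq[of e] ends_subset[of e] by (auto simp: S_def)
    qed
    then have "down_closed (K \<union> S)" using K by (intro down_closed_Un) (auto simp: S_def)
    then have cl: "down_closed (K \<union> (S - K))" by simp
    have "u \<in> S - K" using u dis KJ by (auto simp: S_def down_closed_def)
    then have "\<not> S - K \<subset> J" using min[of "S - K"] cl by auto
    moreover have "S - K \<subseteq> J"
      using reachable_down_closed[OF KJ, of u] u inner_pinned_disjoint by (auto simp: S_def)
    ultimately have "S - K = J" by auto
    then show ?thesis using w by (auto simp: S_def)
  qed
  then show "J \<subseteq> scc v" using v by (auto simp: scc_def)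
  show "scc v \<subseteq> J" by (rule scc_subset_layer[OF K KJ dis v])
qed

definition components :: "('v, 'e) component set" where
  "components = (\<lambda>v. (scc v, out (scc v))) ` I"

section \<open>Strong components of the contracted digraph\<close>

lemma reachable_contract_pinned:
  assumes "u \<in> I" "v \<in> I"
  shows "Some u \<rightarrow>\<^sup>*\<^bsub>contract_pinned G D\<^esub> Some v \<longleftrightarrow> (u, v) \<in> (arcs_ends D)\<^sup>*"
proof
  let ?C = "contract_pinned G D"
  let ?c = "\<lambda>v. if v \<in> P then None else Some v"
  have C: "arcs_ends ?C = (\<lambda>e. (Some (tail D e), ?c (head D e))) ` E"
    using tail_in_inner inner_pinned_disjoint
    by (force simp: arcs_ends_conv contract_pinned_def Let_def arcs_eq)
  show "(u, v) \<in> (arcs_ends D)\<^sup>*" if "Some u \<rightarrow>\<^sup>*\<^bsub>?C\<^esub> Some v"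
  proof -
    \<comment> \<open>Every arc of the contracted digraph starts at some
      \<open>Some (tail D e)\<close>, so \<open>None\<close> can only be the last vertex of a walk,
      and a walk ending at an inner vertex lifts to \<open>D\<close>.\<close>
    have "(Some u, z) \<in> (arcs_ends ?C)\<^sup>* \<Longrightarrow> z = Some w \<Longrightarrow> (u, w) \<in> (arcs_ends D)\<^sup>*" for z w
    proof (induction arbitrary: w rule: rtrancl_induct)
      case (step x y)
      then obtain e where e: "e \<in> E" "x = Some (tail D e)" "y = ?c (head D e)" by (auto simp: C)
      then have "(u, tail D e) \<in> (arcs_ends D)\<^sup>*" "w = head D e"
        using step.IH step.prems by (auto split: if_splits)
      then show ?case using reachable_head[OF _ e(1)] by blast
    qed simp
    then show ?thesis using reachable_rtranclI[OF that] by blast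
  qed
  have V: "verts ?C = insert None (Some ` I)" by (simp add: contract_pinned_def Let_def)
  show "Some u \<rightarrow>\<^sup>*\<^bsub>?C\<^esub> Some v" if "(u, v) \<in> (arcs_ends D)\<^sup>*"
  proof -
    \<comment> \<open>Reachability asks each visited vertex to belong to the digraph, hence
      \<open>rtrancl_on\<close>. The end is stated as \<open>?c v\<close> because the induction must
      also cover walks that end in a pinned vertex.\<close>
    have "(Some u, ?c v) \<in> rtrancl_on (verts ?C) (arcs_ends ?C)"
      using that
    proof induction
      case base
      then show ?case using assms(1) inner_pinned_disjoint by (auto simp: V)
    next
      case (step x y)
      then obtain e where e: "e \<in> E" "x = tail D e" "y = head D e" by (auto simp: arcs_ends_iff)
      have cx: "?c x = Some x" using e tail_in_inner[of e] inner_pinned_disjoint by auto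
      have cy: "?c y \<in> verts ?C" using e ends_eq[of e] ends_subset[of e] by (auto simp: V)
      have "(?c x, ?c y) \<in> arcs_ends ?C" unfolding cx using e by (auto simp: C)
      from rtrancl_on_into_rtrancl_on[OF step.IH this cy] show ?case .
    qed
    moreover have "v \<notin> P" using assms(2) inner_pinned_disjoint by auto
    ultimately show ?thesis by (simp add: reachable_def)
  qed
qed

lemma scc_components_eq: "scc_components G D = components"
proof -
  let ?C = "contract_pinned G D"
  have V: "verts ?C = insert None (Some ` I)" by (simp add: contract_pinned_def Let_def)
  interpret C: wf_digraph ?C
  proof
    fix e assume "e \<in> arcs ?C"
    then have e: "e \<in> E" by (simp add: contract_pinned_def Let_def arcs_eq)
    then have "tail D e \<in> I \<union> P" "head D e \<in> I \<union> P" using ends_eq[of e] ends_subset[of e] by auto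
    then show "tail ?C e \<in> verts ?C" "head ?C e \<in> verts ?C"
      by (auto simp: contract_pinned_def Let_def)
  qed
  have reach: "Some u \<rightarrow>\<^sup>*\<^bsub>?C\<^esub> Some v \<longleftrightarrow> u \<in> I \<and> v \<in> I \<and> (u, v) \<in> (arcs_ends D)\<^sup>*" for u v
    using reachable_contract_pinned[of u v] C.reachable_in_verts[of "Some u" "Some v"]
    by (auto simp: V)
  have "(\<exists>S\<in>C.sccs. None \<notin> verts S \<and> verts S = Some ` X) \<longleftrightarrow> Some ` X \<in> C.sccs_verts" for X
    unfolding C.sccs_verts_conv by auto
  moreover have "Some ` X \<in> C.sccs_verts \<longleftrightarrow> X \<in> scc ` I" for X
  proof
    assume X: "Some ` X \<in> C.sccs_verts"
    then obtain v where v: "v \<in> X" unfolding C.in_sccs_verts_conv_reachable by auto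
    have 1: "u \<in> I \<and> w \<in> I \<and> (u, w) \<in> (arcs_ends D)\<^sup>*" if "u \<in> X" "w \<in> X" for u w
      using X that reach[of u w] unfolding C.in_sccs_verts_conv_reachable by simp
    have 2: "u \<in> X" if "w \<in> X" "Some w \<rightarrow>\<^sup>*\<^bsub>?C\<^esub> Some u" "Some u \<rightarrow>\<^sup>*\<^bsub>?C\<^esub> Some w" for u w
    proof (rule ccontr)
      assume "u \<notin> X"
      then have "Some w \<in> Some ` X" "Some u \<notin> Some ` X" using that by auto
      then show False using X that unfolding C.in_sccs_verts_conv_reachable by blast
    qed
    have "X = scc v"
    proof
      show "X \<subseteq> scc v" using 1 v by (auto simp: scc_def)
      show "scc v \<subseteq> X"
      proof
        fix u assume u: "u \<in> scc v"
        then have "u \<in> I" "v \<in> I" using 1[OF v v] scc_subset_inner by auto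
        then show "u \<in> X" using 2[OF v, of u] reach[of u v] reach[of v u] u by (simp add: scc_def)
      qed
    qed
    then show "X \<in> scc ` I" using 1[OF v v] by auto
  next
    assume "X \<in> scc ` I"
    then obtain v where v: "v \<in> I" "X = scc v" by auto
    show "Some ` X \<in> C.sccs_verts"
      unfolding C.in_sccs_verts_conv_reachable
    proof (intro conjI ballI allI impI)
      show "Some ` X \<noteq> {}" using v scc_self by auto
    next
      fix a b assume "a \<in> Some ` X" "b \<in> Some ` X"
      then obtain x y where xy: "a = Some x" "b = Some y" "x \<in> scc v" "y \<in> scc v" using v by auto
      then have "x \<in> I" "y \<in> I" using scc_subset_inner[OF v(1)] by auto
      moreover have "(x, y) \<in> (arcs_ends D)\<^sup>*"
        using xy rtrancl_trans[of x v "arcs_ends D" y] by (simp add: scc_def)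
      ultimately show "a \<rightarrow>\<^sup>*\<^bsub>?C\<^esub> b" using reach[of x y] xy by simp
    next
      fix a b assume a: "a \<in> Some ` X" and b: "b \<notin> Some ` X"
      then obtain x where x: "a = Some x" "x \<in> scc v" using v by auto
      show "\<not> a \<rightarrow>\<^sup>*\<^bsub>?C\<^esub> b \<or> \<not> b \<rightarrow>\<^sup>*\<^bsub>?C\<^esub> a"
      proof (rule ccontr)
        assume n: "\<not> ?thesis"
        show False
        proof (cases b)
          \<comment> \<open>The ground has no outgoing arc, so it reaches no inner vertex and cannot
            enlarge \<open>X\<close>.\<close>
          case None
          have "(None, Some x) \<in> (arcs_ends ?C)\<^sup>*"
            using n None x(1) reachable_rtranclI by auto
          then obtain z where "(None, z) \<in> arcs_ends ?C" by (cases rule: converse_rtranclE) auto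
          then obtain e where "e \<in> E" "tail D e \<in> P"
            by (auto simp: arcs_ends_conv contract_pinned_def Let_def arcs_eq split: if_splits)
          then show False using tail_in_inner inner_pinned_disjoint by blast
        next
          case (Some y)
          then have "y \<in> scc x" using n x reach[of x y] reach[of y x] by (simp add: scc_def)
          then have "y \<in> X" using scc_eq[OF x(2)] v by simp
          then show False using b Some by simp
        qed
      qed
    qed
  qed
  moreover have "{e \<in> arcs D. tail D e \<in> X} = out X" for X by (auto simp: out_def arcs_eq)
  ultimately show ?thesis unfolding scc_components_def components_def by auto
qed

subsection \<open>Assur components\<close>

text \<open>Entries depend on the graph only through \<open>ends\<close>. Hence the matrix of a
  layer is a submatrix of that of \<open>G\<close>, also where inner vertices of \<open>G\<close>
  have become pinned.\<close>

lemma rigidity_coeff_layer: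
  "rigidity_coeff d \<lparr>inner_verts = J, pinned_verts = Q, edges = F, ends = ends G\<rparr> p = rigidity_coeff d G p"
  by (simp add: fun_eq_iff rigidity_coeff_def rigidity_entries_def other_end_def)

text \<open>Rows are independent on the closed set \<open>K \<union> J\<close> because they vanish outside of it; the
  transposed argument then removes \<open>K\<close>.\<close>

lemma layer_isostatic:
  assumes p: "configuration d G p" "nonsingular d G p"
    and K: "down_closed K" and KJ: "down_closed (K \<union> J)" and dis: "J \<inter> K = {}"
    and Q: "Q \<subseteq> I \<union> P" "Q \<inter> J = {}" "\<And>e. e \<in> out J \<Longrightarrow> ends G e \<subseteq> J \<union> Q"
  shows "pinned_isostatic d \<lparr>inner_verts = J, pinned_verts = Q, edges = out J, ends = ends G\<rparr>"
proof -
  let ?H = "\<lparr>inner_verts = J, pinned_verts = Q, edges = out J, ends = ends G\<rparr>"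
  let ?M = "rigidity_coeff d G p"
  have JI: "J \<subseteq> I" and KJI: "K \<union> J \<subseteq> I" using KJ by (auto simp: down_closed_def)
  have fin: "finite J" "finite Q" "finite (K \<union> J)"
    using finite_subset[OF JI] finite_subset[OF Q(1)] finite_subset[OF KJI] finite_graph by auto
  have "rows_indep ?M (out (K \<union> J)) ((K \<union> J) \<times> {..<d})"
  proof (rule rows_indep_subset[OF p(2)[unfolded nonsingular_def] finite_graph(3) out_subset])
    fix e c assume e: "e \<in> out (K \<union> J)" and c: "c \<in> I \<times> {..<d} - (K \<union> J) \<times> {..<d}"
    then obtain v k where v: "c = (v, k)" "v \<in> I" "v \<notin> K \<union> J" "k < d" by auto
    have "ends G e \<subseteq> K \<union> J \<union> P" using KJ e by (simp add: down_closed_def)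
    then show "?M e c = 0" using v inner_pinned_disjoint by (auto intro: rigidity_coeff_eq_0)
  qed
  moreover have "card (out (K \<union> J)) = card ((K \<union> J) \<times> {..<d})"
    using card_out[OF KJI] by (simp add: card_cartesian_product mult.commute)
  ultimately have "rows_indep (\<lambda>c e. ?M e c) ((K \<union> J) \<times> {..<d}) (out (K \<union> J))"
    using fin finite_out rows_indep_transpose[of "out (K \<union> J)" "(K \<union> J) \<times> {..<d}" ?M] by simp
  then have "rows_indep (\<lambda>c e. ?M e c) (J \<times> {..<d}) (out J)"
  proof (rule rows_indep_subset)
    fix c e assume "c \<in> J \<times> {..<d}" and "e \<in> out (K \<union> J) - out J"
    then obtain v k where v: "c = (v, k)" "v \<in> J" "k < d" and "e \<in> out (K \<union> J) - out J" by auto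
    then have "e \<in> out K" by (auto simp: out_def)
    then have "ends G e \<subseteq> K \<union> P" using K by (simp add: down_closed_def)
    then have "v \<notin> ends G e" using v dis JI inner_pinned_disjoint by blast
    then show "?M e c = 0" using v rigidity_coeff_eq_0 by simp
  qed (use fin in auto)
  moreover have "card (J \<times> {..<d}) = card (out J)"
    using card_out[OF JI] by (simp add: card_cartesian_product mult.commute)
  ultimately have "rows_indep ?M (out J) (J \<times> {..<d})"
    using rows_indep_transpose[of "J \<times> {..<d}" "out J" "\<lambda>c e. ?M e c"] fin finite_out by simp
  then have "nonsingular d ?H p" unfolding nonsingular_def rigidity_coeff_layer by simp
  moreover have "configuration d ?H p" using p(1) JI Q(1) by (auto simp: configuration_def)
  moreover have "pinned_graph ?H"
    unfolding pinned_graph_def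
  proof (intro conjI ballI)
    fix e assume "e \<in> edges ?H"
    then have e: "e \<in> E" "tail D e \<in> J" "e \<in> out J" by (auto simp: out_def)
    show "card (ends ?H e) = 2" using pinned_graph e by (simp add: pinned_graph_def)
    show "ends ?H e \<subseteq> inner_verts ?H \<union> pinned_verts ?H" using Q(3) e by simp
    show "ends ?H e \<inter> inner_verts ?H \<noteq> {}" using e ends_eq by simp
  qed (use fin finite_out Q in auto)
  ultimately show ?thesis unfolding pinned_isostatic_iff using card_out[OF JI] by auto
qed

text \<open>Here \<open>H\<close> is any isostatic graph over the closed ground, minimal or not. All
  its edges turn out to have their tails among its inner vertices, and it has too many edges to omit
  any member of \<open>out (inner_verts H)\<close>.\<close>

lemma isostatic_layer:
  assumes H: "pinned_isostatic d H" "inner_verts H \<subseteq> I - K" "pinned_verts H \<subseteq> K \<union> P"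
      "edges H \<subseteq> E" "ends H = ends G"
    and K: "down_closed K"
  shows "edges H = out (inner_verts H)" "down_closed (K \<union> inner_verts H)"
proof -
  let ?J = "inner_verts H"
  from H(1) have g: "pinned_graph H" and card: "card (edges H) = d * card ?J"
    unfolding pinned_isostatic_iff by auto
  have sub: "ends G e \<subseteq> K \<union> ?J \<union> P" if "e \<in> edges H" for e
    using g that H(3,5) unfolding pinned_graph_def by fastforce
  show out: "edges H = out ?J"
  proof (rule edges_eq_out)
    fix e assume e: "e \<in> edges H"
    then have eE: "e \<in> E" using H(4) by auto
    \<comment> \<open>An edge directed out of \<open>K\<close> has both ends in \<open>K\<close> and
      the pinned vertices, whereas each edge of \<open>H\<close> meets the inner vertices of
      \<open>H\<close>.\<close>
    have "tail D e \<notin> K"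
    proof
      assume "tail D e \<in> K"
      then have "ends G e \<subseteq> K \<union> P" using K eE by (simp add: down_closed_def out_def)
      moreover have "ends G e \<inter> ?J \<noteq> {}" using g e H(5) by (auto simp: pinned_graph_def)
      ultimately show False using H(2) inner_pinned_disjoint by auto
    qed
    then show "tail D e \<in> ?J"
      using sub[OF e] ends_eq[OF eE] tail_in_inner[OF eE] inner_pinned_disjoint by auto
  qed (use H card in auto)
  show "down_closed (K \<union> ?J)"
    using K H(2) sub out by (intro down_closed_Un) auto
qed

text \<open>The ground without the pinned vertices of \<open>G\<close>: closed sets contain inner
  vertices only, so this is the part that can be \<open>down_closed\<close>.\<close>

definition placed :: "('v, 'e) pgraph list \<Rightarrow> 'v set" where
  "placed Hs = (\<Union>H\<in>set Hs. inner_verts H)"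

lemma ground_eq: "ground G Hs = P \<union> placed Hs"
  by (simp add: ground_def placed_def)

text \<open>Minimality among isostatic subgraphs is turned into minimality among closed extensions
  of \<open>K\<close>: a smaller closed extension would carry an isostatic subgraph of
  \<open>H\<close>.\<close>

lemma assur_component_layer:
  assumes p: "configuration d G p" "nonsingular d G p" and K: "down_closed K"
    and H: "assur_component d G (P \<union> K) H"
  shows "edges H = out (inner_verts H)" "down_closed (K \<union> inner_verts H)"
    "inner_verts H \<in> scc ` I"
proof -
  let ?J = "inner_verts H" and ?Q = "pinned_verts H"
  from H have iso: "pinned_isostatic d H" and ne: "?J \<noteq> {}" and J: "?J \<subseteq> I - K"
    and Q: "?Q \<subseteq> K \<union> P" and eH: "edges H \<subseteq> E" "ends H = ends G"
    and min: "\<And>H'. pinned_subgraph H' H \<Longrightarrow> pinned_isostatic d H' \<Longrightarrow> inner_verts H' \<noteq> {} \<Longrightarrow>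
      \<not> inner_verts H' \<subset> ?J"
    unfolding assur_component_def assur_def by blast+
  from iso have g: "pinned_graph H" by (simp add: pinned_isostatic_iff)
  show out: "edges H = out ?J" and KJ: "down_closed (K \<union> ?J)"
    using isostatic_layer[OF iso J Q eH K] by auto
  have dis: "?J \<inter> K = {}" using J by auto
  have "\<not> down_closed (K \<union> J')" if J': "J' \<noteq> {}" "J' \<subset> ?J" for J'
  proof
    assume KJ': "down_closed (K \<union> J')"
    \<comment> \<open>The pinned set of \<open>H\<close> is kept, since a pinned subgraph of
      \<open>H\<close> may only be pinned there. The ends still fit: they lie in
      \<open>?J \<union> ?Q\<close> as ends of an edge of \<open>H\<close>, and in
      \<open>K \<union> J' \<union> P\<close> by closedness.\<close>
    let ?H' = "\<lparr>inner_verts = J', pinned_verts = ?Q, edges = out J', ends = ends G\<rparr>"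
    have "ends G e \<subseteq> J' \<union> ?Q" if e: "e \<in> out J'" for e
    proof -
      have "e \<in> edges H" using e J'(2) out by (auto simp: out_def)
      then have "ends G e \<subseteq> ?J \<union> ?Q" using g eH(2) by (auto simp: pinned_graph_def)
      moreover have "ends G e \<subseteq> K \<union> J' \<union> P" using KJ' e by (auto simp: down_closed_def out_def)
      ultimately show ?thesis using J inner_pinned_disjoint by blast
    qed
    moreover have "?Q \<inter> J' = {}" using g J'(2) by (auto simp: pinned_graph_def)
    moreover have "?Q \<subseteq> I \<union> P" using Q K by (auto simp: down_closed_def)
    ultimately have iso': "pinned_isostatic d ?H'"
      using J' dis by (intro layer_isostatic[OF p K KJ']) auto
    then have "pinned_subgraph ?H' H"
      using J' eH out by (auto simp: pinned_subgraph_def pinned_isostatic_iff out_def)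
    then show False using min[OF _ iso'] J' by simp
  qed
  then obtain v where "v \<in> ?J" "?J = scc v"
    using minimal_layer_eq_scc[OF K KJ dis] ne by blast
  then show "?J \<in> scc ` I" using J by auto
qed

text \<open>Closedness is claimed for all prefixes of the run because the triangular shape of the
  resulting matrix is read off from them. Distinctness of the inner sets lets the length of the run
  be counted by strong components.\<close>

lemma assur_run_layers:
  assumes p: "configuration d G p" "nonsingular d G p"
  shows "assur_run d G Hs \<Longrightarrow> down_closed (placed (take k Hs)) \<and> distinct (map inner_verts Hs) \<and>
    (\<forall>H\<in>set Hs. edges H = out (inner_verts H) \<and> inner_verts H \<in> scc ` I)"
proof (induction arbitrary: k rule: assur_run.induct)
  case start
  then show ?case by (simp add: placed_def down_closed_empty)
next
  case (step Hs H)
  have cl: "down_closed (placed Hs)" using step.IH[of "length Hs"] by simp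
  note H = assur_component_layer[OF p cl step.hyps(2)[unfolded ground_eq]]
  have "inner_verts H \<noteq> {}" "inner_verts H \<inter> placed Hs = {}"
    using step.hyps(2) by (auto simp: assur_component_def ground_eq)
  then have new: "inner_verts H \<notin> inner_verts ` set Hs" by (auto simp: placed_def)
  have "down_closed (placed (take k (Hs @ [H])))"
  proof (cases "k \<le> length Hs")
    case False
    then have "placed (take k (Hs @ [H])) = placed Hs \<union> inner_verts H" by (auto simp: placed_def)
    then show ?thesis using H(2) by simp
  qed (use step.IH in simp)
  then show ?case using step.IH H new by auto
qed

section \<open>Existence of complete runs\<close>

lemma assur_run_extend:
  assumes p: "configuration d G p" "nonsingular d G p"
    and run: "assur_run d G Hs" and incomplete: "placed Hs \<noteq> I"
  shows "\<exists>H. assur_component d G (ground G Hs) H"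
proof -
  let ?K = "placed Hs"
  have K: "down_closed ?K" using assur_run_layers[OF p run, of "length Hs"] by simp
  \<comment> \<open>The next component is sought as a minimal closed extension; one exists because
    \<open>I - ?K\<close> is a candidate.\<close>
  let ?S = "{J. J \<noteq> {} \<and> J \<inter> ?K = {} \<and> down_closed (?K \<union> J)}"
  have "I - ?K \<noteq> {}" using K incomplete by (auto simp: down_closed_def)
  moreover have "?K \<union> (I - ?K) = I" using K by (auto simp: down_closed_def)
  ultimately have "I - ?K \<in> ?S" using down_closed_inner by auto
  moreover have "finite ?S"
    by (rule finite_subset[of _ "Pow I"]) (use finite_graph in \<open>auto simp: down_closed_def\<close>)
  ultimately obtain J where J: "J \<in> ?S" and min: "\<And>J'. J' \<in> ?S \<Longrightarrow> J' \<subseteq> J \<Longrightarrow> J = J'"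
    using finite_has_minimal[of ?S] by (metis (no_types, lifting) empty_iff)
  have dis: "J \<inter> ?K = {}" and KJ: "down_closed (?K \<union> J)" and ne: "J \<noteq> {}" using J by auto
  \<comment> \<open>Pinning the entire ground makes closedness of \<open>?K \<union> J\<close> say
    exactly that the ends of the edges fit.\<close>
  let ?H = "\<lparr>inner_verts = J, pinned_verts = P \<union> ?K, edges = out J, ends = ends G\<rparr>"
  have sub: "ends G e \<subseteq> J \<union> (P \<union> ?K)" if "e \<in> out J" for e
    using KJ that by (auto simp: down_closed_def out_def)
  have JI: "J \<subseteq> I" "?K \<subseteq> I" using KJ by (auto simp: down_closed_def)
  have iso: "pinned_isostatic d ?H"
    using layer_isostatic[OF p K KJ dis _ _ sub] JI dis inner_pinned_disjoint by blast
  \<comment> \<open>A smaller isostatic subgraph would yield a smaller closed extension of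
    \<open>?K\<close>, against the choice of \<open>J\<close>.\<close>
  have "\<not> (pinned_subgraph H' ?H \<and> pinned_isostatic d H' \<and> inner_verts H' \<noteq> {} \<and>
      inner_verts H' \<subset> inner_verts ?H)" for H'
  proof
    assume H': "pinned_subgraph H' ?H \<and> pinned_isostatic d H' \<and> inner_verts H' \<noteq> {} \<and>
      inner_verts H' \<subset> inner_verts ?H"
    then have "inner_verts H' \<subseteq> I - ?K" "pinned_verts H' \<subseteq> ?K \<union> P" "edges H' \<subseteq> E"
      "ends H' = ends G"
      using JI dis out_subset[of J] by (auto simp: pinned_subgraph_def)
    then have "down_closed (?K \<union> inner_verts H')" using isostatic_layer[OF _ _ _ _ _ K] H' by blast
    then have "inner_verts H' \<in> ?S" using H' dis by auto
    then show False using min H' by auto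
  qed
  then have "assur_component d G (ground G Hs) ?H"
    using iso ne JI dis inner_pinned_disjoint out_subset[of J]
    by (auto simp: assur_component_def assur_def ground_eq)
  then show ?thesis by blast
qed

lemma complete_assur_run_iff:
  assumes "configuration d G p" "nonsingular d G p"
  shows "complete_assur_run d G Hs \<longleftrightarrow> assur_run d G Hs \<and> placed Hs = I"
proof -
  have "placed Hs \<subseteq> I" if "assur_run d G Hs"
    using assur_run_layers[OF assms that, of "length Hs"] by (simp add: down_closed_def)
  then show ?thesis
    using inner_pinned_disjoint by (auto simp: complete_assur_run_def ground_eq)
qed

lemma assur_run_completion:
  assumes p: "configuration d G p" "nonsingular d G p"
  shows "assur_run d G Hs \<Longrightarrow> \<exists>Ks. complete_assur_run d G (Hs @ Ks)"
proof (induction "card (I - placed Hs)" arbitrary: Hs rule: less_induct)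
  case less
  show ?case
  proof (cases "placed Hs = I")
    case True
    then have "complete_assur_run d G (Hs @ [])"
      using less.prems complete_assur_run_iff[OF p, of Hs] by simp
    then show ?thesis ..
  next
    case False
    obtain H where H: "assur_component d G (ground G Hs) H"
      using assur_run_extend[OF p less.prems False] by blast
    then have "inner_verts H \<noteq> {}" "inner_verts H \<subseteq> I - placed Hs"
      by (auto simp: assur_component_def ground_eq)
    then have "I - placed (Hs @ [H]) \<subset> I - placed Hs" by (auto simp: placed_def)
    then have "card (I - placed (Hs @ [H])) < card (I - placed Hs)"
      using finite_graph(1) by (intro psubset_card_mono) auto
    from less.hyps[OF this assur_run.step[OF less.prems H]]
    obtain Ks where "complete_assur_run d G (Hs @ [H] @ Ks)" by auto
    then show ?thesis by blast
  qed
qed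

lemma assur_components_eq:
  assumes p: "configuration d G p" "nonsingular d G p" and run: "complete_assur_run d G Hs"
  shows "assur_components Hs = components"
proof -
  have pl: "placed Hs = I" and r: "assur_run d G Hs" using run complete_assur_run_iff[OF p] by auto
  note layers = assur_run_layers[OF p r, of 0]
  show ?thesis
  proof
    show "assur_components Hs \<subseteq> components"
      using layers by (auto simp: assur_components_def components_def)
    show "components \<subseteq> assur_components Hs"
    proof
      fix A assume "A \<in> components"
      then obtain v where v: "v \<in> I" "A = (scc v, out (scc v))" by (auto simp: components_def)
      then obtain H where H: "H \<in> set Hs" "v \<in> inner_verts H" using pl by (auto simp: placed_def)
      then have "inner_verts H = scc v" using layers scc_eq by fastforce
      then show "A \<in> assur_components Hs" using H layers v by (auto simp: assur_components_def)
    qed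
  qed
qed

end

subsection \<open>Block decompositions\<close>

lemma take_drop_concat_map:
  "concat (map f xs) = concat (map f (take k xs)) @ concat (map f (drop k xs))"
  by (metis append_take_drop_id concat_append map_append)

lemma distinct_concat_disjoint:
  assumes "distinct (concat (map f xs))" "i < j" "j < length xs"
  shows "set (f (xs ! i)) \<inter> set (f (xs ! j)) = {}"
proof -
  have "set (concat (map f (take j xs))) \<inter> set (concat (map f (drop j xs))) = {}"
    using assms(1) take_drop_concat_map[of f xs j] by (metis distinct_append)
  moreover have "xs ! i \<in> set (take j xs)"
    using assms(2,3) nth_mem[of i "take j xs"] by simp
  moreover have "xs ! j \<in> set (drop j xs)"
    using assms(3) by (simp add: Cons_nth_drop_Suc[symmetric])
  ultimately show ?thesis by auto
qed

lemma nth_append_set_left: "i < length xs \<Longrightarrow> (xs @ ys) ! i \<in> set xs"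
  by (simp add: nth_append)

lemma nth_append_set_right: "length xs \<le> i \<Longrightarrow> i < length xs + length ys \<Longrightarrow> (xs @ ys) ! i \<in> set ys"
  by (simp add: nth_append)

text \<open>Entry \<open>(i, j)\<close> belongs to the rows of the first \<open>Suc k\<close> blocks and to the columns of the
  others iff \<open>i\<close> and \<open>j div d\<close> are separated by the lengths of the prefixes of the two
  concatenated lists.\<close>

lemma lower_block_triangular_rigidity_iff:
  assumes d: "d \<ge> 1" and size: "\<forall>b\<in>set bs. length (snd b) = d * length (fst b)"
    and carrier: "\<And>e v. e \<in> set (concat (map snd bs)) \<Longrightarrow> rigidity_entries d G p e v \<in> carrier_vec d"
  shows "lower_block_triangular (map (\<lambda>b. length (snd b)) bs)
       (rigidity_matrix d G p (concat (map snd bs)) (concat (map fst bs))) \<longleftrightarrow>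
     (\<forall>k < length bs. \<forall>b\<in>set (take (Suc k) bs). \<forall>b'\<in>set (drop (Suc k) bs).
        \<forall>e\<in>set (snd b). \<forall>v\<in>set (fst b'). rigidity_entries d G p e v = 0\<^sub>v d)"
proof -
  let ?es = "concat (map snd bs)" and ?vs = "concat (map fst bs)"
  let ?ns = "map (\<lambda>b. length (snd b)) bs" and ?A = "rigidity_matrix d G p ?es ?vs"
  let ?ek = "\<lambda>k. concat (map snd (take (Suc k) bs))" and ?vk = "\<lambda>k. concat (map fst (take (Suc k) bs))"
  let ?vr = "\<lambda>k. concat (map fst (drop (Suc k) bs))"
  have len_es: "length (concat (map snd xs)) = sum_list (map (\<lambda>b. length (snd b)) xs)"
    for xs :: "('a list \<times> 'b list) list" by (simp add: length_concat comp_def)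
  have len_vs: "d * length (concat (map fst xs)) = sum_list (map (\<lambda>b. length (snd b)) xs)"
    if "set xs \<subseteq> set bs" for xs
    using that size by (induction xs) (auto simp: algebra_simps)
  have ns: "sum_list ?ns = length ?es" "sum_list ?ns = d * length ?vs"
    using len_es[of bs] len_vs[of bs] by auto
  have nk: "sum_list (take (Suc k) ?ns) = length (?ek k)"
    "sum_list (take (Suc k) ?ns) = d * length (?vk k)" for k
    using len_es[of "take (Suc k) bs"] len_vs[of "take (Suc k) bs"] set_take_subset[of "Suc k" bs]
    by (auto simp: take_map)
  have split_es: "?es = ?ek k @ concat (map snd (drop (Suc k) bs))" for k
    by (rule take_drop_concat_map)
  have split_vs: "?vs = ?vk k @ ?vr k" for k by (rule take_drop_concat_map)
  have A: "?A \<in> carrier_mat (sum_list ?ns) (sum_list ?ns)"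
    using rigidity_matrix_carrier[of d G p ?es ?vs] ns by metis
  have entry: "?A $$ (i, j) = rigidity_entries d G p (?es ! i) (?vs ! (j div d)) $ (j mod d)"
    if "i < sum_list ?ns" "j < sum_list ?ns" for i j
    using that ns by (simp add: rigidity_matrix_def)
  have eq: "(\<forall>i j. i < sum_list (take (Suc k) ?ns) \<longrightarrow> sum_list (take (Suc k) ?ns) \<le> j \<longrightarrow>
          j < sum_list ?ns \<longrightarrow> ?A $$ (i, j) = 0) \<longleftrightarrow>
        (\<forall>e\<in>set (?ek k). \<forall>v\<in>set (?vr k). rigidity_entries d G p e v = 0\<^sub>v d)" (is "?L \<longleftrightarrow> ?R") for k
  proof
    assume L: ?L
    show ?R
    proof (intro ballI)
      fix e v assume e: "e \<in> set (?ek k)" and v: "v \<in> set (?vr k)"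
      obtain i where i: "i < length (?ek k)" "e = ?ek k ! i" using e by (metis in_set_conv_nth)
      obtain m where m: "m < length (?vr k)" "v = ?vr k ! m" using v by (metis in_set_conv_nth)
      have ei: "?es ! i = e" using split_es[of k] i by (metis nth_append)
      have vm: "?vs ! (length (?vk k) + m) = v" using split_vs[of k] m by (metis nth_append_length_plus)
      have len: "length ?vs = length (?vk k) + length (?vr k)" using split_vs[of k] by (metis length_append)
      have lene: "length (?ek k) \<le> length ?es" using split_es[of k] by (metis le_add1 length_append)
      have "rigidity_entries d G p e v $ c = 0" if c: "c < d" for c
      proof -
        let ?j = "d * (length (?vk k) + m) + c"
        have "d * (length (?vk k) + m) + d \<le> d * length ?vs"
          using mult_le_mono2[of "length (?vk k) + m + 1" "length ?vs" d] m(1) len by (simp add: algebra_simps)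
        then have j: "?j < sum_list ?ns" using c ns(2) by linarith
        have j': "sum_list (take (Suc k) ?ns) \<le> ?j" unfolding nk(2) by (simp add: algebra_simps)
        have i': "i < sum_list (take (Suc k) ?ns)" using i(1) nk(1)[of k] by linarith
        have i'': "i < sum_list ?ns" using i(1) lene ns(1) by linarith
        have "?A $$ (i, ?j) = 0" using L i' j' j by blast
        moreover have "?j div d = length (?vk k) + m" "?j mod d = c" using c by auto
        ultimately show ?thesis using entry[OF i'' j] ei vm by simp
      qed
      moreover have "e \<in> set ?es" using e split_es[of k] by (metis Un_iff set_append)
      ultimately show "rigidity_entries d G p e v = 0\<^sub>v d"
        using carrier[of e v] by (intro eq_vecI) auto
    qed
  next
    assume R: ?R
    show ?L
    proof (intro allI impI)
      fix i j assume ij: "i < sum_list (take (Suc k) ?ns)" "sum_list (take (Suc k) ?ns) \<le> j" "j < sum_list ?ns"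
      then have i: "i < length (?ek k)" using nk(1)[of k] by linarith
      have e: "?es ! i \<in> set (?ek k)" using i split_es[of k] nth_append_set_left by metis
      have "length (?vk k) \<le> j div d" using ij(2) d nk(2)[of k]
        by (simp add: less_eq_div_iff_mult_less_eq mult.commute)
      moreover have "j div d < length (?vk k) + length (?vr k)"
        using ij(3) d ns(2) split_vs[of k] by (metis length_append less_mult_imp_div_less mult.commute)
      ultimately have "(?vk k @ ?vr k) ! (j div d) \<in> set (?vr k)"
        by (rule nth_append_set_right)
      then have v: "?vs ! (j div d) \<in> set (?vr k)" using split_vs[of k] by metis
      have "rigidity_entries d G p (?es ! i) (?vs ! (j div d)) = 0\<^sub>v d" using R e v by blast
      moreover have "j mod d < d" using d by simp
      moreover have "i < sum_list ?ns" using ij by linarith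
      ultimately show "?A $$ (i, j) = 0" using entry[of i j] ij(3) by simp
    qed
  qed
  have flat: "(\<forall>e\<in>set (?ek k). \<forall>v\<in>set (?vr k). rigidity_entries d G p e v = 0\<^sub>v d) \<longleftrightarrow>
      (\<forall>b\<in>set (take (Suc k) bs). \<forall>b'\<in>set (drop (Suc k) bs).
        \<forall>e\<in>set (snd b). \<forall>v\<in>set (fst b'). rigidity_entries d G p e v = 0\<^sub>v d)" for k
    by auto
  show ?thesis
    unfolding lower_block_triangular_def eq flat using A by (simp only: length_map simp_thms)
qed

text \<open>The identity is adjoined before the transitive closure, so agreement on distinct
  components suffices. On the diagonal the relations may differ: for \<open>d \<ge> 1\<close> a
  single-vertex component is related to itself by \<open>assur_above\<close> through the tails of
  its edges, but not by \<open>scc_above\<close>.\<close>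

lemma component_order_cong:
  assumes "\<And>A B. A \<in> C \<Longrightarrow> B \<in> C \<Longrightarrow> A \<noteq> B \<Longrightarrow> R A B \<longleftrightarrow> R' A B"
  shows "component_order C R = component_order C R'"
proof -
  have "{(A, B). A \<in> C \<and> B \<in> C \<and> R A B} \<union> Id_on C = {(A, B). A \<in> C \<and> B \<in> C \<and> R' A B} \<union> Id_on C"
    using assms by (auto simp: Id_on_def)
  then show ?thesis by (simp add: component_order_def)
qed

section \<open>Block decompositions as chains of closed sets\<close>

context oriented_pinned_graph
begin

text \<open>This replaces vanishing entries by non-incidence and has no configuration in it, so all
  nonsingular configurations admit the same block decompositions.\<close>

definition layered_blocks :: "('v list \<times> 'e list) list \<Rightarrow> bool" where
  "layered_blocks bs \<longleftrightarrow>
     enumerates (concat (map fst bs)) I \<and> enumerates (concat (map snd bs)) E \<and>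
     (\<forall>b\<in>set bs. fst b \<noteq> [] \<and> length (snd b) = d * length (fst b)) \<and>
     (\<forall>i < length bs. \<forall>j < length bs. i < j \<longrightarrow>
        (\<forall>e\<in>set (snd (bs ! i)). \<forall>v\<in>set (fst (bs ! j)). v \<notin> ends G e))"

lemma layered_blocks_triangular:
  assumes "layered_blocks bs" "i < j" "j < length bs" "e \<in> set (snd (bs ! i))" "v \<in> ends G e"
  shows "v \<notin> set (fst (bs ! j))"
  using assms less_trans[OF assms(2,3)] unfolding layered_blocks_def by blast

text \<open>For nonsingular \<open>p\<close> an entry vector vanishes exactly when the vertex is not
  an end of the edge, and two blocks are separated by some cut after block \<open>k\<close> exactly
  when their positions satisfy \<open>i < j\<close>.\<close>

lemma block_decomposition_iff_layered:
  assumes d: "d \<ge> 1" and p: "configuration d G p" "nonsingular d G p"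
  shows "block_decomposition d G p bs \<longleftrightarrow> layered_blocks bs"
proof (cases "enumerates (concat (map fst bs)) I \<and> enumerates (concat (map snd bs)) E \<and>
     (\<forall>b\<in>set bs. fst b \<noteq> [] \<and> length (snd b) = d * length (fst b))")
  case True
  let ?Z = "\<lambda>b b'. \<forall>e\<in>set (snd b). \<forall>v\<in>set (fst b'). v \<notin> ends G e"
  have E: "set (concat (map snd bs)) = E" using True by (auto simp: enumerates_def)
  have "lower_block_triangular (map (\<lambda>b. length (snd b)) bs)
       (rigidity_matrix d G p (concat (map snd bs)) (concat (map fst bs))) \<longleftrightarrow>
     (\<forall>k < length bs. \<forall>b\<in>set (take (Suc k) bs). \<forall>b'\<in>set (drop (Suc k) bs).
        \<forall>e\<in>set (snd b). \<forall>v\<in>set (fst b'). rigidity_entries d G p e v = 0\<^sub>v d)"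
    using d True rigidity_entries_carrier[OF pinned_graph p(1)] unfolding E[symmetric]
    by (intro lower_block_triangular_rigidity_iff) auto
  also have "\<dots> \<longleftrightarrow> (\<forall>k < length bs. \<forall>b\<in>set (take (Suc k) bs). \<forall>b'\<in>set (drop (Suc k) bs). ?Z b b')"
  proof -
    have "rigidity_entries d G p e v = 0\<^sub>v d \<longleftrightarrow> v \<notin> ends G e"
      if "b \<in> set (take k bs)" "e \<in> set (snd b)" for b k e v
    proof -
      have "e \<in> E" using that in_set_takeD[OF that(1)] E by auto
      then show ?thesis by (rule rigidity_entries_eq_0_iff[OF pinned_graph p])
    qed
    then show ?thesis by (simp cong: ball_cong)
  qed
  also have "\<dots> \<longleftrightarrow> (\<forall>i < length bs. \<forall>j < length bs. i < j \<longrightarrow> ?Z (bs ! i) (bs ! j))"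
  proof
    assume Z: "\<forall>k < length bs. \<forall>b\<in>set (take (Suc k) bs). \<forall>b'\<in>set (drop (Suc k) bs). ?Z b b'"
    show "\<forall>i < length bs. \<forall>j < length bs. i < j \<longrightarrow> ?Z (bs ! i) (bs ! j)"
    proof (intro allI impI)
      fix i j assume ij: "i < length bs" "j < length bs" "i < j"
      have "bs ! i \<in> set (take (Suc i) bs)" using ij by (simp add: take_Suc_conv_app_nth)
      moreover have "bs ! j \<in> set (drop (Suc i) bs)"
        using ij by (auto simp: in_set_conv_nth intro!: exI[of _ "j - Suc i"])
      ultimately show "?Z (bs ! i) (bs ! j)" using Z ij(1) by blast
    qed
  next
    assume Z: "\<forall>i < length bs. \<forall>j < length bs. i < j \<longrightarrow> ?Z (bs ! i) (bs ! j)"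
    show "\<forall>k < length bs. \<forall>b\<in>set (take (Suc k) bs). \<forall>b'\<in>set (drop (Suc k) bs). ?Z b b'"
    proof (intro allI impI ballI)
      fix k b b' e v
      assume k: "k < length bs" and b: "b \<in> set (take (Suc k) bs)" "b' \<in> set (drop (Suc k) bs)"
        and ev: "e \<in> set (snd b)" "v \<in> set (fst b')"
      obtain i where i: "i < Suc k" "i < length bs" "b = bs ! i"
        using b(1) by (auto simp: in_set_conv_nth)
      obtain m where "m < length (drop (Suc k) bs)" "b' = drop (Suc k) bs ! m"
        using b(2) by (metis in_set_conv_nth)
      then have m: "Suc k + m < length bs" "b' = bs ! (Suc k + m)" by auto
      have "i < Suc k + m" using i by simp
      then show "v \<notin> ends G e" using Z i m ev by blast
    qed
  qed
  finally show ?thesis using True unfolding block_decomposition_def layered_blocks_def by blast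
qed (auto simp: block_decomposition_def layered_blocks_def)

text \<open>Both claims need one joint induction. Edges of block \<open>k\<close> have no end in a
  later block by the triangular shape, and no tail in an earlier one because earlier blocks already
  own all edges out of their vertices. The row count then leaves only \<open>out\<close>.\<close>

lemma layered_blocks_down_closed:
  assumes bs: "layered_blocks bs"
  shows "k \<le> length bs \<Longrightarrow> down_closed (\<Union>i<k. set (fst (bs ! i))) \<and>
    (\<forall>i<k. set (snd (bs ! i)) = out (set (fst (bs ! i))))"
proof (induction k)
  case 0
  then show ?case by (simp add: down_closed_empty)
next
  case (Suc k)
  let ?K = "\<Union>i<k. set (fst (bs ! i))" and ?J = "set (fst (bs ! k))" and ?F = "set (snd (bs ! k))"
  from Suc have k: "k < length bs" and K: "down_closed ?K"
    and out: "\<And>i. i < k \<Longrightarrow> set (snd (bs ! i)) = out (set (fst (bs ! i)))" by auto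
  have V: "distinct (concat (map fst bs))" "(\<Union>b\<in>set bs. set (fst b)) = I"
    and E: "distinct (concat (map snd bs))" "(\<Union>b\<in>set bs. set (snd b)) = E"
    using bs by (auto simp: layered_blocks_def enumerates_def)
  have mem: "bs ! k \<in> set bs" using k by simp
  have JI: "?J \<subseteq> I" "?F \<subseteq> E" using V(2) E(2) mem by auto
  have "distinct (fst (bs ! k))" "distinct (snd (bs ! k))"
    using V(1) E(1) mem by (auto simp: distinct_concat_iff)
  then have card: "card ?F = d * card ?J"
    using bs mem by (simp add: layered_blocks_def distinct_card)
  have sub: "ends G e \<subseteq> ?K \<union> ?J \<union> P" if e: "e \<in> ?F" for e
  proof
    fix v assume v: "v \<in> ends G e"
    show "v \<in> ?K \<union> ?J \<union> P"
    proof (rule ccontr)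
      assume n: "v \<notin> ?K \<union> ?J \<union> P"
      have "e \<in> E" using e JI by auto
      then have "v \<in> I" using ends_subset v n by blast
      then obtain j where j: "j < length bs" "v \<in> set (fst (bs ! j))"
        using V(2) by (force simp: in_set_conv_nth)
      have "k < j" using n j by (metis UN_I UnCI lessThan_iff linorder_neqE_nat)
      then show False using layered_blocks_triangular[OF bs _ j(1) e v] j(2) by blast
    qed
  qed
  have "tail D e \<in> ?J" if e: "e \<in> ?F" for e
  proof -
    have eE: "e \<in> E" using e JI by auto
    have "tail D e \<notin> ?K"
    proof
      assume "tail D e \<in> ?K"
      then obtain i where i: "i < k" "e \<in> out (set (fst (bs ! i)))" using eE by (auto simp: out_def)
      then have "e \<in> set (snd (bs ! i))" using out by simp
      then show False using distinct_concat_disjoint[OF E(1) i(1) k] e by auto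
    qed
    then show ?thesis using sub[OF e] ends_eq[OF eE] tail_in_inner[OF eE] inner_pinned_disjoint by auto
  qed
  then have F: "?F = out ?J" using edges_eq_out JI card by blast
  then have "down_closed (?K \<union> ?J)" using down_closed_Un[OF K JI(1)] sub by simp
  moreover have "(\<Union>i<Suc k. set (fst (bs ! i))) = ?K \<union> ?J" by (auto simp: less_Suc_eq)
  ultimately show ?case using out F by (auto simp: less_Suc_eq)
qed

lemma layered_blocks_disjoint:
  assumes "layered_blocks bs" "i < length bs" "j < length bs" "i \<noteq> j"
  shows "set (fst (bs ! i)) \<inter> set (fst (bs ! j)) = {}"
proof -
  have "distinct (concat (map fst bs))" using assms(1) by (simp add: layered_blocks_def enumerates_def)
  from distinct_concat_disjoint[OF this] show ?thesis
    using assms(2-4) by (metis Int_commute linorder_neqE_nat)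
qed

lemma layered_blocks_scc_subset:
  assumes bs: "layered_blocks bs" and k: "k < length bs" and v: "v \<in> set (fst (bs ! k))"
  shows "scc v \<subseteq> set (fst (bs ! k))"
proof (rule scc_subset_layer[OF _ _ _ v])
  let ?K = "\<Union>i<k. set (fst (bs ! i))"
  show "down_closed ?K" using layered_blocks_down_closed[OF bs, of k] k by simp
  have "(\<Union>i<Suc k. set (fst (bs ! i))) = ?K \<union> set (fst (bs ! k))" by (auto simp: less_Suc_eq)
  then show "down_closed (?K \<union> set (fst (bs ! k)))"
    using layered_blocks_down_closed[OF bs, of "Suc k"] k by simp
  have "set (fst (bs ! k)) \<inter> set (fst (bs ! i)) = {}" if "i < k" for i
    using layered_blocks_disjoint[OF bs k, of i] that k by simp
  then show "set (fst (bs ! k)) \<inter> ?K = {}" by blast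
qed

text \<open>Each block is a nonempty union of strong components, so the blocks number at most the
  strong components, with equality only if each block is a single one.\<close>

lemma layered_blocks_length:
  assumes bs: "layered_blocks bs"
  shows "length bs \<le> card (scc ` I)"
    and "length bs = card (scc ` I) \<Longrightarrow> block_components bs = components"
proof -
  define c where "c i = scc (hd (fst (bs ! i)))" for i
  have ne: "hd (fst (bs ! i)) \<in> set (fst (bs ! i))" if "i < length bs" for i
    using bs that by (simp add: layered_blocks_def)
  have UN: "(\<Union>b\<in>set bs. set (fst b)) = I"
    using bs by (auto simp: layered_blocks_def enumerates_def)
  have inI: "set (fst (bs ! i)) \<subseteq> I" if "i < length bs" for i
    using UN that nth_mem by blast
  have csub: "c i \<subseteq> set (fst (bs ! i))" if "i < length bs" for i
    using layered_blocks_scc_subset[OF bs that ne[OF that]] by (simp add: c_def)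
  have inj: "inj_on c {..<length bs}"
  proof
    fix i j assume ij: "i \<in> {..<length bs}" "j \<in> {..<length bs}" "c i = c j"
    then have "hd (fst (bs ! i)) \<in> c i" "c i \<subseteq> set (fst (bs ! i))" "c i \<subseteq> set (fst (bs ! j))"
      using csub[of i] csub[of j] scc_self by (auto simp: c_def)
    then show "i = j" using layered_blocks_disjoint[OF bs, of i j] ij by auto
  qed
  have im: "c ` {..<length bs} \<subseteq> scc ` I" using ne inI by (auto simp: c_def)
  have fin: "finite (scc ` I)" using finite_graph by simp
  show "length bs \<le> card (scc ` I)" using card_inj_on_le[OF inj im fin] by simp
  assume "length bs = card (scc ` I)"
  then have onto: "c ` {..<length bs} = scc ` I"
    using card_subset_eq[OF fin im] card_image[OF inj] by simp
  have eq: "set (fst (bs ! i)) = scc v" if i: "i < length bs" and v: "v \<in> set (fst (bs ! i))" for i v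
  proof -
    \<comment> \<open>By surjectivity of \<open>c\<close> the strong component of \<open>w\<close>
      represents some block \<open>j\<close> and lies inside it; as it contains \<open>w\<close>,
      which is in block \<open>i\<close>, the blocks agree.\<close>
    have ci: "scc w = c i" if w: "w \<in> set (fst (bs ! i))" for w
    proof -
      have "scc w \<in> c ` {..<length bs}" using onto inI[OF i] w by blast
      then obtain j where j: "j < length bs" "scc w = c j" by auto
      then have "w \<in> set (fst (bs ! j))" using csub scc_self by blast
      then have "i = j" using layered_blocks_disjoint[OF bs i j(1)] w by blast
      then show ?thesis using j by simp
    qed
    have "set (fst (bs ! i)) \<subseteq> c i" using ci scc_self by blast
    then show ?thesis using csub[OF i] ci[OF v] by auto
  qed
  have out: "set (snd (bs ! i)) = out (set (fst (bs ! i)))" if "i < length bs" for i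
    using layered_blocks_down_closed[OF bs, of "length bs"] that by simp
  show "block_components bs = components"
  proof
    show "block_components bs \<subseteq> components"
    proof
      fix A assume "A \<in> block_components bs"
      then obtain i where i: "i < length bs" "A = block_component (bs ! i)"
        by (auto simp: block_components_def in_set_conv_nth)
      let ?v = "hd (fst (bs ! i))"
      have "A = (scc ?v, out (scc ?v))"
        using eq[OF i(1) ne[OF i(1)]] out[OF i(1)] i(2) by (simp add: block_component_def)
      moreover have "?v \<in> I" using ne[OF i(1)] inI[OF i(1)] by blast
      ultimately show "A \<in> components" by (auto simp: components_def)
    qed
    show "components \<subseteq> block_components bs"
    proof
      fix A assume "A \<in> components"
      then obtain v where v: "v \<in> I" "A = (scc v, out (scc v))" by (auto simp: components_def)
      from v(1) obtain b where b: "b \<in> set bs" "v \<in> set (fst b)"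
        unfolding UN[symmetric] by blast
      then obtain i where i: "i < length bs" "b = bs ! i" by (auto simp: in_set_conv_nth)
      have "A = block_component b" using eq[of i v] out[of i] i b v by (simp add: block_component_def)
      then show "A \<in> block_components bs" using b by (auto simp: block_components_def)
    qed
  qed
qed

text \<open>The order of the run is a block order, with the inner vertices of a component as columns
  and its edges as rows. This shows that the bound on the number of blocks is attained.\<close>

lemma layered_blocks_from_run:
  assumes d: "d \<ge> 1" and p: "configuration d G p" "nonsingular d G p" and run: "complete_assur_run d G Hs"
  obtains bs where "layered_blocks bs" "length bs = card (scc ` I)"
proof -
  have pl: "placed Hs = I" and r: "assur_run d G Hs" using run complete_assur_run_iff[OF p] by auto
  note layers = assur_run_layers[OF p r]
  have "\<exists>b. enumerates (fst b) (inner_verts H) \<and> enumerates (snd b) (edges H)" if "H \<in> set Hs" for H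
  proof -
    have "inner_verts H \<subseteq> I" using that pl by (auto simp: placed_def)
    then have "finite (inner_verts H)" "finite (edges H)"
      using layers[of 0] that finite_out finite_subset[OF _ finite_graph(1)] by auto
    then show ?thesis using enumerates_exists by (metis fst_conv snd_conv)
  qed
  then obtain f where f: "\<And>H. H \<in> set Hs \<Longrightarrow> enumerates (fst (f H)) (inner_verts H) \<and>
      enumerates (snd (f H)) (edges H)" by metis
  define bs where "bs = map f Hs"
  have sets: "set (fst (f H)) = inner_verts H" "set (snd (f H)) = out (inner_verts H)"
    "distinct (fst (f H))" "distinct (snd (f H))" if "H \<in> set Hs" for H
    using f[OF that] layers[of 0] that by (auto simp: enumerates_def)
  have nonempty: "inner_verts H \<noteq> {}" and inner: "inner_verts H \<subseteq> I" if "H \<in> set Hs" for H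
    using layers[of 0] that scc_self scc_subset_inner by blast+
  have disj: "inner_verts H \<inter> inner_verts H' = {}"
    if HH': "H \<in> set Hs" "H' \<in> set Hs" "H \<noteq> H'" for H H'
  proof -
    have "inner_verts H \<noteq> inner_verts H'"
      using layers[of 0] that by (auto simp: distinct_map inj_on_def)
    moreover obtain u w where "inner_verts H = scc u" "inner_verts H' = scc w"
      using layers[of 0] HH'(1,2) by blast
    ultimately show ?thesis using scc_disjoint[of u w] by simp
  qed
  have distinct_parts: "distinct (concat (map g Hs))"
    if "\<And>H. H \<in> set Hs \<Longrightarrow> distinct (g H)"
      "\<And>H H'. H \<in> set Hs \<Longrightarrow> H' \<in> set Hs \<Longrightarrow> H \<noteq> H' \<Longrightarrow> set (g H) \<inter> set (g H') = {}"
      "\<And>H. H \<in> set Hs \<Longrightarrow> g H \<noteq> []" for g :: "('v, 'e) pgraph \<Rightarrow> 'x list"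
  proof (rule distinct_concat)
    have "inj_on g (set Hs)" using that(2,3) by (fastforce intro: inj_onI)
    then show "distinct (map g Hs)" using layers[of 0] by (simp add: distinct_map)
  qed (use that in auto)
  \<comment> \<open>\<open>distinct_concat\<close> asks for pairwise distinct sublists, and disjoint
    lists are sure to be distinct only when nonempty. For the edge lists this rests on
    \<open>d \<ge> 1\<close>.\<close>
  have nonempty_out: "out (inner_verts H) \<noteq> {}" if "H \<in> set Hs" for H
    using card_out[OF inner[OF that]] nonempty[OF that] d finite_subset[OF inner[OF that] finite_graph(1)]
    by (auto simp: card_eq_0_iff)
  have map_bs: "map fst bs = map (fst \<circ> f) Hs" "map snd bs = map (snd \<circ> f) Hs"
    by (simp_all add: bs_def)
  have UN: "(\<Union>H\<in>set Hs. inner_verts H) = I" using pl by (simp add: placed_def)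
  have "layered_blocks bs"
    unfolding layered_blocks_def
  proof (intro conjI)
    show "enumerates (concat (map fst bs)) I"
      unfolding enumerates_def map_bs
    proof
      show "distinct (concat (map (fst \<circ> f) Hs))"
      proof (rule distinct_parts)
        fix H assume "H \<in> set Hs"
        then show "(fst \<circ> f) H \<noteq> []" using sets(1)[of H] nonempty[of H] by auto
      qed (use sets disj in auto)
    qed (use UN sets in auto)
    show "enumerates (concat (map snd bs)) E"
      unfolding enumerates_def map_bs
    proof
      show "distinct (concat (map (snd \<circ> f) Hs))"
      proof (rule distinct_parts)
        fix H assume "H \<in> set Hs"
        then show "(snd \<circ> f) H \<noteq> []" using sets(2)[of H] nonempty_out[of H] by auto
      next
        fix H H' assume "H \<in> set Hs" "H' \<in> set Hs" "H \<noteq> H'"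
        then show "set ((snd \<circ> f) H) \<inter> set ((snd \<circ> f) H') = {}"
          using sets(2) disj[of H H'] by (auto simp: out_def)
      qed (use sets in auto)
      have "(\<Union>H\<in>set Hs. out (inner_verts H)) = out I" unfolding UN[symmetric] by (auto simp: out_def)
      also have "\<dots> = E" using tail_in_inner by (auto simp: out_def)
      finally show "set (concat (map (snd \<circ> f) Hs)) = E" using sets by auto
    qed
    show "\<forall>b\<in>set bs. fst b \<noteq> [] \<and> length (snd b) = d * length (fst b)"
    proof
      fix b assume "b \<in> set bs"
      then obtain H where H: "H \<in> set Hs" "b = f H" by (auto simp: bs_def)
      have "length (fst b) = card (inner_verts H)" "length (snd b) = card (out (inner_verts H))"
        using sets[OF H(1)] H(2) distinct_card by metis+
      moreover have "fst b \<noteq> []" using sets(1)[OF H(1)] nonempty[OF H(1)] H(2) by auto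
      ultimately show "fst b \<noteq> [] \<and> length (snd b) = d * length (fst b)"
        using card_out[OF inner[OF H(1)]] by simp
    qed
    show "\<forall>i<length bs. \<forall>j<length bs. i < j \<longrightarrow>
        (\<forall>e\<in>set (snd (bs ! i)). \<forall>v\<in>set (fst (bs ! j)). v \<notin> ends G e)"
    proof (intro allI impI ballI notI)
      fix i j e v
      assume ij: "i < length bs" "j < length bs" "i < j" and e: "e \<in> set (snd (bs ! i))"
        and v: "v \<in> set (fst (bs ! j))" "v \<in> ends G e"
      have ij': "i < length Hs" "j < length Hs" using ij by (auto simp: bs_def)
      have e': "e \<in> out (inner_verts (Hs ! i))" and v': "v \<in> inner_verts (Hs ! j)"
        using e v(1) ij' sets nth_mem by (auto simp: bs_def)
      \<comment> \<open>The prefix of length \<open>Suc i\<close> is used because ends of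
        \<open>e\<close> may lie in block \<open>i\<close> itself; its closedness excludes all later
        blocks.\<close>
      have "Hs ! i \<in> set (take (Suc i) Hs)" using ij'(1) by (simp add: take_Suc_conv_app_nth)
      then have "e \<in> out (placed (take (Suc i) Hs))" using e' by (auto simp: out_def placed_def)
      then have "v \<in> placed (take (Suc i) Hs) \<union> P"
        using layers[of "Suc i"] v(2) by (auto simp: down_closed_def)
      moreover have "v \<notin> P" using v' inner[of "Hs ! j"] ij'(2) inner_pinned_disjoint by auto
      ultimately obtain H where H: "H \<in> set (take (Suc i) Hs)" "v \<in> inner_verts H"
        by (auto simp: placed_def)
      then obtain m where m: "m < Suc i" "m < length Hs" "H = Hs ! m" by (auto simp: in_set_conv_nth)
      have "distinct Hs" using layers[of 0] by (simp add: distinct_map)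
      then have "H \<noteq> Hs ! j" using m ij ij' by (simp add: nth_eq_iff_index_eq)
      then show False using disj[of H "Hs ! j"] H v' m ij'(2) by auto
    qed
  qed
  moreover have "length bs = card (scc ` I)"
  proof -
    have "fst ` components = scc ` I" by (force simp: components_def)
    moreover have "fst ` assur_components Hs = inner_verts ` set Hs"
      by (force simp: assur_components_def)
    ultimately have "inner_verts ` set Hs = scc ` I" using assur_components_eq[OF p run] by simp
    moreover have "card (inner_verts ` set Hs) = length Hs"
      using layers[of 0] distinct_card[of "map inner_verts Hs"] by simp
    ultimately show ?thesis by (simp add: bs_def)
  qed
  ultimately show ?thesis by (rule that)
qed

section \<open>Partial orders on the components\<close>

lemma layered_blocks_order_extends:
  assumes bs: "layered_blocks bs" and comps: "block_components bs = C"
  shows "block_order_extends bs (component_order C (assur_above G))"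
proof -
  \<comment> \<open>Ends of an edge of block \<open>i\<close> avoid all later blocks, so one step of
    the relation never raises the position; the transitive closure inherits this.\<close>
  have le: "j \<le> i" if "i < length bs" "j < length bs"
    "block_component (bs ! i) = block_component (bs ! j) \<or>
      assur_above G (block_component (bs ! i)) (block_component (bs ! j))" for i j
  proof (rule ccontr)
    assume "\<not> j \<le> i"
    then have ij: "i < j" by simp
    have "fst (bs ! i) \<noteq> []" using bs that(1) by (simp add: layered_blocks_def)
    moreover have "set (fst (bs ! i)) \<inter> set (fst (bs ! j)) = {}"
      using layered_blocks_disjoint[OF bs that(1,2)] ij by simp
    ultimately have "assur_above G (block_component (bs ! i)) (block_component (bs ! j))"
      using that(3) by (auto simp: block_component_def)
    then show False using layered_blocks_triangular[OF bs ij that(2)]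
      by (auto simp: assur_above_def block_component_def)
  qed
  have "(A, B) \<in> component_order C (assur_above G) \<Longrightarrow>
      \<forall>i < length bs. \<forall>j < length bs. block_component (bs ! i) = A \<longrightarrow> block_component (bs ! j) = B \<longrightarrow> j \<le> i"
    for A B
    unfolding component_order_def
  proof (induction rule: trancl_induct)
    case (base B)
    then have "A = B \<or> assur_above G A B" by (auto simp: Id_on_def)
    then show ?case using le by blast
  next
    case (step B B')
    then have BB': "B = B' \<or> assur_above G B B'" and "B \<in> C" by (auto simp: Id_on_def)
    then obtain m where m: "m < length bs" "B = block_component (bs ! m)"
      using comps by (auto simp: block_components_def in_set_conv_nth)
    show ?case
    proof (intro allI impI)
      fix i j assume ij: "i < length bs" "j < length bs" "block_component (bs ! i) = A"
        "block_component (bs ! j) = B'"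
      have "m \<le> i" using step.IH ij m by blast
      moreover have "j \<le> m" using le[OF m(1) ij(2)] BB' unfolding m(2) ij(4)[symmetric] by blast
      ultimately show "j \<le> i" by simp
    qed
  qed
  then show ?thesis unfolding block_order_extends_def by blast
qed

text \<open>The position of a block is a ranking of the components, and mutually comparable
  components have equal rank; this gives antisymmetry.\<close>

lemma components_partial_order:
  assumes bs: "layered_blocks bs" and comps: "block_components bs = C"
  shows "partial_order_on C (component_order C (assur_above G))"
proof -
  let ?r = "component_order C (assur_above G)"
  have sub: "?r \<subseteq> C \<times> C"
    unfolding component_order_def by (rule trancl_subset_Sigma) auto
  have "Id_on C \<subseteq> ?r" unfolding component_order_def by auto
  then have "refl_on C ?r" by (auto simp: refl_on_def)
  moreover have "trans ?r" by (simp add: component_order_def)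
  moreover have "antisym ?r"
  proof (rule antisymI)
    fix A B assume AB: "(A, B) \<in> ?r" "(B, A) \<in> ?r"
    then have "A \<in> C" "B \<in> C" using sub by auto
    then obtain i j where ij: "i < length bs" "A = block_component (bs ! i)"
      "j < length bs" "B = block_component (bs ! j)"
      unfolding comps[symmetric] block_components_def by (metis imageE in_set_conv_nth)
    have "j \<le> i" "i \<le> j"
      using layered_blocks_order_extends[OF bs comps] ij AB by (auto simp: block_order_extends_def)
    then show "A = B" using ij by simp
  qed
  ultimately show ?thesis using sub by (simp add: partial_order_on_def preorder_on_def)
qed

text \<open>Distinct components are disjoint, so an edge whose tail is in \<open>A\<close> can meet
  \<open>B\<close> only with its head.\<close>

lemma scc_above_iff_assur_above:
  assumes "A \<in> components" "B \<in> components" "A \<noteq> B"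
  shows "scc_above D A B \<longleftrightarrow> assur_above G A B"
proof -
  obtain u v where u: "A = (scc u, out (scc u))" and v: "B = (scc v, out (scc v))"
    using assms(1,2) by (auto simp: components_def)
  then have "scc u \<inter> scc v = {}" using assms(3) scc_disjoint by auto
  then show ?thesis
    using ends_eq unfolding u v scc_above_def assur_above_def by (fastforce simp: out_def arcs_eq)
qed

lemma block_above_iff_assur_above:
  assumes p: "configuration d G p" "nonsingular d G p" and A: "A \<in> components"
  shows "block_above d G p A B \<longleftrightarrow> assur_above G A B"
proof -
  have "snd A \<subseteq> E" using A by (auto simp: components_def out_def)
  then have "rigidity_entries d G p e v = 0\<^sub>v d \<longleftrightarrow> v \<notin> ends G e" if "e \<in> snd A" for e v
    using rigidity_entries_eq_0_iff[OF pinned_graph p] that by blast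
  then show ?thesis by (auto simp: block_above_def assur_above_def)
qed

end

section \<open>The three decompositions compared\<close>

theorem theorem3p5:
  fixes G :: "('v, 'e) pgraph" and d :: nat
  assumes "d \<ge> 1" and "pinned_isostatic d G"
  shows "(\<exists>D. directed_orientation d G D) \<and>
    (\<forall>Hs. assur_run d G Hs \<longrightarrow> (\<exists>Ks. complete_assur_run d G (Hs @ Ks))) \<and>
    (\<forall>D Hs p. directed_orientation d G D \<longrightarrow> complete_assur_run d G Hs \<longrightarrow> generic d G p \<longrightarrow>
      (let C1 = assur_components Hs; order1 = component_order C1 (assur_above G);
           C2 = scc_components G D; order2 = component_order C2 (scc_above D) in
       partial_order_on C1 order1 \<and>
       C1 = C2 \<and> order1 = order2 \<and>
       (\<exists>bs. max_block_decomposition d G p bs) \<and>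
       (\<forall>bs. max_block_decomposition d G p bs \<longrightarrow>
          block_components bs = C1 \<and>
          component_order (block_components bs) (block_above d G p) = order1 \<and>
          block_order_extends bs order1)))"
proof (intro conjI allI impI)
  have G: "pinned_graph G" using assms(2) by (simp add: pinned_isostatic_iff)
  show ex: "\<exists>D. directed_orientation d G D" by (rule directed_orientation_exists[OF assms(2)])
  show "\<exists>Ks. complete_assur_run d G (Hs @ Ks)" if "assur_run d G Hs" for Hs
  proof -
    \<comment> \<open>Runs do not refer to an orientation, so any orientation and any nonsingular
      \<open>p\<close> may be used to complete them.\<close>
    obtain D where "directed_orientation d G D" using ex by blast
    then interpret oriented_pinned_graph d G D using G by unfold_locales
    obtain p where "configuration d G p" "nonsingular d G p"
      using assms(2) by (auto simp: pinned_isostatic_iff)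
    from assur_run_completion[OF this that] show ?thesis .
  qed
  fix D Hs p
  assume D: "directed_orientation d G D" and run: "complete_assur_run d G Hs" and gen: "generic d G p"
  interpret oriented_pinned_graph d G D using G D by unfold_locales
  have p: "configuration d G p" "nonsingular d G p"
    using gen generic_imp_nonsingular[OF assms(2)] by (auto simp: generic_def)
  obtain bs0 where bs0: "layered_blocks bs0" "length bs0 = card (scc ` inner_verts G)"
    using layered_blocks_from_run[OF assms(1) p run] .
  \<comment> \<open>Since \<open>bs0\<close> attains the bound on the length, maximality means
    having as many blocks as there are strong components.\<close>
  have max: "max_block_decomposition d G p bs \<longleftrightarrow>
      layered_blocks bs \<and> length bs = card (scc ` inner_verts G)" for bs
    unfolding max_block_decomposition_def block_decomposition_iff_layered[OF assms(1) p]
    using bs0 layered_blocks_length(1) by (metis le_antisym)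
  have C1: "assur_components Hs = components" by (rule assur_components_eq[OF p run])
  have order2: "component_order components (scc_above D) = component_order components (assur_above G)"
    by (rule component_order_cong) (rule scc_above_iff_assur_above)
  have order3: "component_order components (block_above d G p) = component_order components (assur_above G)"
    by (rule component_order_cong) (rule block_above_iff_assur_above[OF p])
  have comps: "block_components bs = components"
    if "layered_blocks bs \<and> length bs = card (scc ` inner_verts G)" for bs
    using that layered_blocks_length(2) by blast
  have "partial_order_on components (component_order components (assur_above G))"
    by (rule components_partial_order[OF bs0(1)]) (rule comps, use bs0 in blast)
  moreover have "block_order_extends bs (component_order components (assur_above G))"
    if "layered_blocks bs \<and> length bs = card (scc ` inner_verts G)" for bs
    using that layered_blocks_order_extends[OF _ comps[OF that]] by blast
  ultimately show "let C1 = assur_components Hs; order1 = component_order C1 (assur_above G);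
           C2 = scc_components G D; order2 = component_order C2 (scc_above D) in
       partial_order_on C1 order1 \<and>
       C1 = C2 \<and> order1 = order2 \<and>
       (\<exists>bs. max_block_decomposition d G p bs) \<and>
       (\<forall>bs. max_block_decomposition d G p bs \<longrightarrow>
          block_components bs = C1 \<and>
          component_order (block_components bs) (block_above d G p) = order1 \<and>
          block_order_extends bs order1)"
    unfolding Let_def C1 scc_components_eq max order2 using bs0 comps order3 by auto
qed

end
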